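(* Let $\Omega\subset\mathbb{H}$ be a circular domain and let $f,g\in\mathcal{SEM}(\Omega)\setminus\{0\}$ be such that the operator $\mathcal{L}_{f,g}:\mathcal{SEM}(\Omega)\to\mathcal{SEM}(\Omega)$, $\mathcal{L}_{f,g}(\chi)=f*\chi*g$, is not an isomorphism. If $f$ is a zero divisor, choose $\eta\in\mathbb{H}$ with $|\eta|=1$ and $(f\eta)_0\not\equiv0$, and let $\rho_f$ be the idempotent determined by $f=2(f\eta)_0\,\eta^c*\rho_f$. If $g$ is a zero divisor, choose $\delta\in\mathbb{H}$ with $|\delta|=1$ and $(g\delta)_0\not\equiv0$, and let $\sigma_g$ be the idempotent determined by $g=2(g\delta)_0\,\sigma_g\,\delta^c$. Then, for $\chi\in\mathcal{SEM}(\Omega)$, one has $\chi\in\ker(\mathcal{L}_{f,g})$ if and only if (1) $\rho_f*\chi\equiv0$, if $f$ is a zero divisor and $g$ is not a zero divisor; (2) $\chi*\sigma_g\equiv0$, if $g$ is a zero divisor and $f$ is not a zero divisor; (3) $\rho_f*\chi*\sigma_g\equiv0$, if both $f$ and $g$ are zero divisors.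
   Context: $\mathbb{H}$ denotes the quaternions, $q^c$ the quaternionic conjugate, $\mathbb{S}=\{q\in\mathbb{H}: q^2=-1\}$, and $\mathbb{C}_I=\mathbb{R}+I\mathbb{R}$ for $I\in\mathbb{S}$. For $q=x+Iy$ put $\mathbb{S}_q=\{x+Jy: J\in\mathbb{S}\}$. A domain (connected open set) $\Omega\subset\mathbb{H}$ is circular if $\mathbb{S}_q\subset\Omega$ for all $q\in\Omega$. A function $f$ on a circular open set $\Omega$ is slice regular ($f\in\mathcal{SR}(\Omega)$) if $f(x+Iy)=F_1(x,y)+IF_2(x,y)$ for all $x+Iy\in\Omega$ ($x,y\in\mathbb{R}$, $I\in\mathbb{S}$), with $\mathbb{H}$-valued $F_1$ even in $y$ and $F_2$ odd in $y$, and each restriction $f|_{\Omega\cap\mathbb{C}_I}$ is real differentiable with $\frac12(\partial_x+I\partial_y)f|_{\Omega\cap\mathbb{C}_I}\equiv0$. The $*$-product is $(f*g)(q)=0$ if $f(q)=0$ and $(f*g)(q)=f(q)\,g(f(q)^{-1}qf(q))$ otherwise. $f$ is slice preserving if $f(\Omega\cap\mathbb{C}_I)\subset\mathbb{C}_I$ for every $I\in\mathbb{S}$. A function $f$ is slice semi-regular on $\Omega$ ($f\in\mathcal{SEM}(\Omega)$) if there is a circular open $\widetilde\Omega\subseteq\Omega$ with $f\in\mathcal{SR}(\widetilde\Omega)$ and each point of $\Omega\setminus\widetilde\Omega$ is a pole or a removable singularity; i.e. $\Omega\setminus\widetilde\Omega$ consists of isolated real points and isolated spheres $\mathbb{S}_p$,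 near each of which $\Delta_p^m f$ extends slice regularly for some integer $m\ge0$, where $\Delta_p(q)=q^2-2\mathrm{Re}(p)q+|p|^2$. Functions agreeing where both are defined are identified. $\mathcal{SEM}_{\mathbb{R}}(\Omega)$ is the subset of slice preserving elements; it is a field and the center of the algebra $(\mathcal{SEM}(\Omega),+,* )$, which is a 4-dimensional vector space over it: for an orthonormal basis $(1,I,J,K)$ of $\mathbb{H}$, each $f$ is uniquely $f_0+f_1I+f_2J+f_3K$ with $f_\ell\in\mathcal{SEM}_{\mathbb{R}}(\Omega)$. Set $f^c=f_0-(f_1I+f_2J+f_3K)$, $f^s=f*f^c=f_0^2+f_1^2+f_2^2+f_3^2$, $f_0=(f+f^c)/2$. A zero divisor is $f\not\equiv0$ with $f^s\equiv0$ (equivalently $f\not\equiv 0$ and $f*g\equiv0$ for some $g\not\equiv0$). An idempotent is $\sigma\not\equiv0,1$ with $\sigma*\sigma=\sigma$. For a zero divisor $f$, there is always a unitary $\delta\in\mathbb{H}$ with $(f\delta)_0\not\equiv0$, and then $\sigma_f=(2(f\delta)_0)^{-1}f\delta$ and $\rho_f=(2(f\delta)_0)^{-1}\delta*f=\delta*\sigma_f*\delta^c$ are idempotents satisfying $f=2(f\delta)_0\sigma_f\delta^c=2(f\delta)_0\delta^c*\rho_f$. Isomorphism means isomorphism of $\mathcal{SEM}_{\mathbb{R}}(\Omega)$-vector spaces. *)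

theory Defs
  imports "HOL-Analysis.Analysis" "HOL-Algebra.AbelCoset"
begin

datatype quat = Quat (qre: real) (qim1: real) (qim2: real) (qim3: real)

lemma quat_eq_iff:
  "p = q \<longleftrightarrow> qre p = qre q \<and> qim1 p = qim1 q \<and> qim2 p = qim2 q \<and> qim3 p = qim3 q"
  by (auto intro: quat.expand)

instantiation quat :: ab_group_add
begin

definition "0 = Quat 0 0 0 0"
definition "p + q = Quat (qre p + qre q) (qim1 p + qim1 q) (qim2 p + qim2 q) (qim3 p + qim3 q)"
definition "- q = Quat (- qre q) (- qim1 q) (- qim2 q) (- qim3 q)"
definition "p - q = Quat (qre p - qre q) (qim1 p - qim1 q) (qim2 p - qim2 q) (qim3 p - qim3 q)"

instance
  by standard
    (simp_all add: quat_eq_iff zero_quat_def plus_quat_def uminus_quat_def minus_quat_def)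

end

instantiation quat :: ring_1
begin

definition "1 = Quat 1 0 0 0"
definition "p * q = Quat
  (qre p * qre q - qim1 p * qim1 q - qim2 p * qim2 q - qim3 p * qim3 q)
  (qre p * qim1 q + qim1 p * qre q + qim2 p * qim3 q - qim3 p * qim2 q)
  (qre p * qim2 q - qim1 p * qim3 q + qim2 p * qre q + qim3 p * qim1 q)
  (qre p * qim3 q + qim1 p * qim2 q - qim2 p * qim1 q + qim3 p * qre q)"

instance
  by standard
    (simp_all add: quat_eq_iff zero_quat_def one_quat_def plus_quat_def times_quat_def
      algebra_simps)

end

instantiation quat :: real_algebra_1
begin

definition "r *\<^sub>R q = Quat (r * qre q) (r * qim1 q) (r * qim2 q) (r * qim3 q)"

instance
  by standard
    (simp_all add: quat_eq_iff plus_quat_def times_quat_def scaleR_quat_def algebra_simps)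

end

definition qcnj :: "quat \<Rightarrow> quat"
  where "qcnj q = Quat (qre q) (- qim1 q) (- qim2 q) (- qim3 q)"

instantiation quat :: real_inner
begin

definition "p \<bullet> q = qre p * qre q + qim1 p * qim1 q + qim2 p * qim2 q + qim3 p * qim3 q"
definition "norm (q :: quat) = sqrt (q \<bullet> q)"
definition "dist (p :: quat) q = norm (p - q)"
definition "sgn (q :: quat) = q /\<^sub>R norm q"
definition [code del]:
  "(uniformity :: (quat \<times> quat) filter) = (INF e\<in>{0<..}. principal {(p, q). dist p q < e})"
definition [code del]:
  "open (U :: quat set) \<longleftrightarrow> (\<forall>p\<in>U. eventually (\<lambda>(p', q). p' = p \<longrightarrow> q \<in> U) uniformity)"

instance
proof
  fix p q r :: quat and c :: real
  show "p \<bullet> q = q \<bullet> p" "(p + q) \<bullet> r = p \<bullet> r + q \<bullet> r" "(c *\<^sub>R p) \<bullet> q = c * (p \<bullet> q)" "0 \<le> p \<bullet> p"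
    by (simp_all add: inner_quat_def plus_quat_def scaleR_quat_def algebra_simps)
  have "p \<bullet> p = (qre p)\<^sup>2 + (qim1 p)\<^sup>2 + (qim2 p)\<^sup>2 + (qim3 p)\<^sup>2"
    by (simp add: inner_quat_def power2_eq_square)
  then show "p \<bullet> p = 0 \<longleftrightarrow> p = 0"
    by (simp add: quat_eq_iff zero_quat_def add_nonneg_eq_0_iff)
qed (rule norm_quat_def dist_quat_def sgn_quat_def uniformity_quat_def open_quat_def)+

end

instantiation quat :: real_normed_div_algebra
begin

definition "inverse q = qcnj q /\<^sub>R (q \<bullet> q)"
definition "p div (q :: quat) = p * inverse q"

instance
proof
  fix p q :: quat
  have cnj: "qcnj q * q = (q \<bullet> q) *\<^sub>R 1" "q * qcnj q = (q \<bullet> q) *\<^sub>R 1"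
    by (simp_all add: quat_eq_iff inner_quat_def qcnj_def times_quat_def scaleR_quat_def
        one_quat_def algebra_simps)
  show "q \<noteq> 0 \<Longrightarrow> inverse q * q = 1" "q \<noteq> 0 \<Longrightarrow> q * inverse q = 1"
    by (simp_all add: inverse_quat_def cnj)
  show "p div q = p * inverse q"
    by (rule divide_quat_def)
  show "inverse (0 :: quat) = 0"
    by (simp add: inverse_quat_def quat_eq_iff qcnj_def zero_quat_def scaleR_quat_def)
  have "(p * q) \<bullet> (p * q) = (p \<bullet> p) * (q \<bullet> q)"
    by (simp add: inner_quat_def times_quat_def algebra_simps)
  then show "norm (p * q) = norm p * norm q"
    by (simp add: norm_quat_def real_sqrt_mult)
qed

end

definition quat_i :: quat where "quat_i = Quat 0 1 0 0"
definition quat_j :: quat where "quat_j = Quat 0 0 1 0"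
definition quat_k :: quat where "quat_k = Quat 0 0 0 1"


definition imag_units :: "quat set"  (\<open>\<S>\<close>)
  where "\<S> = {q. q\<^sup>2 = - 1}"

abbreviation slice_pt :: "quat \<Rightarrow> real \<Rightarrow> real \<Rightarrow> quat"
  where "slice_pt I x y \<equiv> of_real x + I * of_real y"

definition slice_plane :: "quat \<Rightarrow> quat set"
  where "slice_plane I = {slice_pt I x y | x y. True}"

definition quat_sphere :: "quat \<Rightarrow> quat set"
  where "quat_sphere q = {slice_pt J x y | I J x y. I \<in> \<S> \<and> J \<in> \<S> \<and> q = slice_pt I x y}"

definition circular :: "quat set \<Rightarrow> bool"
  where "circular \<Omega> \<longleftrightarrow> (\<forall>q\<in>\<Omega>. quat_sphere q \<subseteq> \<Omega>)"

definition circular_domain :: "quat set \<Rightarrow> bool"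
  where "circular_domain \<Omega> \<longleftrightarrow> open \<Omega> \<and> connected \<Omega> \<and> circular \<Omega>"

definition slice_regular_on :: "quat set \<Rightarrow> (quat \<Rightarrow> quat) \<Rightarrow> bool"
  where "slice_regular_on \<Omega> f \<longleftrightarrow> open \<Omega> \<and> circular \<Omega> \<and>
    (\<exists>F1 F2 :: real \<Rightarrow> real \<Rightarrow> quat.
      (\<forall>x y. F1 x (- y) = F1 x y) \<and> (\<forall>x y. F2 x (- y) = - F2 x y) \<and>
      (\<forall>x y. \<forall>I\<in>\<S>. slice_pt I x y \<in> \<Omega> \<longrightarrow> f (slice_pt I x y) = F1 x y + I * F2 x y)) \<and>
    (\<forall>I\<in>\<S>. \<forall>x y. slice_pt I x y \<in> \<Omega> \<longrightarrow>
      (\<exists>D. ((\<lambda>(s, t). f (slice_pt I s t)) has_derivative D) (at (x, y)) \<and>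
           (1 / 2) *\<^sub>R (D (1, 0) + I * D (0, 1)) = 0))"

definition star_fun :: "(quat \<Rightarrow> quat) \<Rightarrow> (quat \<Rightarrow> quat) \<Rightarrow> quat \<Rightarrow> quat"
  where "star_fun f g q = (if f q = 0 then 0 else f q * g (inverse (f q) * q * f q))"


text \<open>
  A semi-regular function on \<open>\<Omega>\<close> is a partial function \<open>f\<close> whose domain of definition
  \<open>dom f \<subseteq> \<Omega>\<close> is the set on which it is required to be slice regular.
\<close>

definition Delta :: "quat \<Rightarrow> quat \<Rightarrow> quat"
  where "Delta p q = q\<^sup>2 - of_real (2 * qre p) * q + of_real ((norm p)\<^sup>2)"

text \<open>
  For real \<open>p\<close>, \<open>quat_sphere p = {p}\<close>, so real points and spheres are treated uniformly.
  That \<open>U\<close> meets the complement of \<open>dom f\<close> at most in \<open>quat_sphere p\<close> says that the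
  singularity is isolated.
\<close>

definition pole_or_removable :: "(quat \<rightharpoonup> quat) \<Rightarrow> quat \<Rightarrow> bool"
  where "pole_or_removable f p \<longleftrightarrow>
    (\<exists>U h (m::nat). p \<in> U \<and> U - quat_sphere p \<subseteq> dom f \<and> slice_regular_on U h \<and>
      (\<forall>q \<in> U - quat_sphere p. h q = Delta p q ^ m * the (f q)))"

definition semi_regular :: "quat set \<Rightarrow> (quat \<rightharpoonup> quat) set"
  where "semi_regular \<Omega> = {f. dom f \<subseteq> \<Omega> \<and> slice_regular_on (dom f) (\<lambda>q. the (f q)) \<and>
    (\<forall>p \<in> \<Omega> - dom f. pole_or_removable f p)}"

definition slice_preserving :: "(quat \<rightharpoonup> quat) \<Rightarrow> bool"
  where "slice_preserving f \<longleftrightarrow>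
    (\<forall>I\<in>\<S>. \<forall>q \<in> dom f \<inter> slice_plane I. the (f q) \<in> slice_plane I)"

definition semi_const :: "quat set \<Rightarrow> quat \<Rightarrow> (quat \<rightharpoonup> quat)"
  where "semi_const \<Omega> c = (\<lambda>q. if q \<in> \<Omega> then Some c else None)"

definition semi_add :: "(quat \<rightharpoonup> quat) \<Rightarrow> (quat \<rightharpoonup> quat) \<Rightarrow> (quat \<rightharpoonup> quat)"
  where "semi_add f g =
    (\<lambda>q. if q \<in> dom f \<inter> dom g then Some (the (f q) + the (g q)) else None)"

text \<open>
  The second factor is evaluated at \<open>f(q)\<^sup>-\<^sup>1 q f(q)\<close>, which lies in \<open>quat_sphere q\<close> and hence in
  the circular set \<open>dom g\<close>.
\<close>

definition semi_star :: "(quat \<rightharpoonup> quat) \<Rightarrow> (quat \<rightharpoonup> quat) \<Rightarrow> (quat \<rightharpoonup> quat)"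
  where "semi_star f g =
    (\<lambda>q. if q \<in> dom f \<inter> dom g then Some (star_fun (\<lambda>p. the (f p)) (\<lambda>p. the (g p)) q) else None)"


type_synonym sem = "(quat \<rightharpoonup> quat) set"

definition sem_rel :: "quat set \<Rightarrow> ((quat \<rightharpoonup> quat) \<times> (quat \<rightharpoonup> quat)) set"
  where "sem_rel \<Omega> = {(f, g). f \<in> semi_regular \<Omega> \<and> g \<in> semi_regular \<Omega> \<and>
    (\<forall>q \<in> dom f \<inter> dom g. f q = g q)}"

definition sem_class :: "quat set \<Rightarrow> (quat \<rightharpoonup> quat) \<Rightarrow> sem"
  where "sem_class \<Omega> f = sem_rel \<Omega> `` {f}"

definition sem_const :: "quat set \<Rightarrow> quat \<Rightarrow> sem"
  where "sem_const \<Omega> c = sem_class \<Omega> (semi_const \<Omega> c)"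

definition SEM :: "quat set \<Rightarrow> sem ring"
  where "SEM \<Omega> =
    \<lparr>carrier = semi_regular \<Omega> // sem_rel \<Omega>,
     monoid.mult = (\<lambda>A B. \<Union>f\<in>A. \<Union>g\<in>B. sem_class \<Omega> (semi_star f g)),
     one = sem_const \<Omega> 1,
     zero = sem_const \<Omega> 0,
     add = (\<lambda>A B. \<Union>f\<in>A. \<Union>g\<in>B. sem_class \<Omega> (semi_add f g))\<rparr>"

definition SEM_R :: "quat set \<Rightarrow> sem ring"
  where "SEM_R \<Omega> = (SEM \<Omega>)
    \<lparr>carrier := {sem_class \<Omega> f | f. f \<in> semi_regular \<Omega> \<and> slice_preserving f}\<rparr>"

text \<open>
  Components with respect to the standard orthonormal basis \<open>1, i, j, k\<close>.  The part \<open>f\<^sub>0\<close> and the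
  conjugate \<open>f\<^sup>c\<close> do not depend on the choice of an orthonormal basis \<open>1, I, J, K\<close>.
\<close>

definition sem_vec :: "quat set \<Rightarrow> sem \<Rightarrow> sem \<Rightarrow> sem \<Rightarrow> sem"
  where "sem_vec \<Omega> f1 f2 f3 =
    f1 \<otimes>\<^bsub>SEM \<Omega>\<^esub> sem_const \<Omega> quat_i \<oplus>\<^bsub>SEM \<Omega>\<^esub> f2 \<otimes>\<^bsub>SEM \<Omega>\<^esub> sem_const \<Omega> quat_j
      \<oplus>\<^bsub>SEM \<Omega>\<^esub> f3 \<otimes>\<^bsub>SEM \<Omega>\<^esub> sem_const \<Omega> quat_k"

definition sem_components :: "quat set \<Rightarrow> sem \<Rightarrow> sem \<Rightarrow> sem \<Rightarrow> sem \<Rightarrow> sem \<Rightarrow> bool"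
  where "sem_components \<Omega> f f0 f1 f2 f3 \<longleftrightarrow>
    {f0, f1, f2, f3} \<subseteq> carrier (SEM_R \<Omega>) \<and> f = f0 \<oplus>\<^bsub>SEM \<Omega>\<^esub> sem_vec \<Omega> f1 f2 f3"

definition sem_re :: "quat set \<Rightarrow> sem \<Rightarrow> sem"
  where "sem_re \<Omega> f = (THE f0. \<exists>f1 f2 f3. sem_components \<Omega> f f0 f1 f2 f3)"

definition sem_cnj :: "quat set \<Rightarrow> sem \<Rightarrow> sem"
  where "sem_cnj \<Omega> f = (THE h. \<exists>f0 f1 f2 f3. sem_components \<Omega> f f0 f1 f2 f3 \<and>
    h = f0 \<ominus>\<^bsub>SEM \<Omega>\<^esub> sem_vec \<Omega> f1 f2 f3)"

definition sem_symm :: "quat set \<Rightarrow> sem \<Rightarrow> sem"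
  where "sem_symm \<Omega> f = f \<otimes>\<^bsub>SEM \<Omega>\<^esub> sem_cnj \<Omega> f"

definition sem_zero_divisor :: "quat set \<Rightarrow> sem \<Rightarrow> bool"
  where "sem_zero_divisor \<Omega> f \<longleftrightarrow>
    f \<in> carrier (SEM \<Omega>) \<and> f \<noteq> \<zero>\<^bsub>SEM \<Omega>\<^esub> \<and> sem_symm \<Omega> f = \<zero>\<^bsub>SEM \<Omega>\<^esub>"

definition sem_idempotent :: "quat set \<Rightarrow> sem \<Rightarrow> bool"
  where "sem_idempotent \<Omega> s \<longleftrightarrow>
    s \<in> carrier (SEM \<Omega>) \<and> s \<noteq> \<zero>\<^bsub>SEM \<Omega>\<^esub> \<and> s \<noteq> \<one>\<^bsub>SEM \<Omega>\<^esub> \<and> s \<otimes>\<^bsub>SEM \<Omega>\<^esub> s = s"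

definition sem_sigma :: "quat set \<Rightarrow> sem \<Rightarrow> quat \<Rightarrow> sem"
  where "sem_sigma \<Omega> f \<delta> = (THE s. sem_idempotent \<Omega> s \<and>
    f = sem_const \<Omega> 2 \<otimes>\<^bsub>SEM \<Omega>\<^esub> sem_re \<Omega> (f \<otimes>\<^bsub>SEM \<Omega>\<^esub> sem_const \<Omega> \<delta>)
          \<otimes>\<^bsub>SEM \<Omega>\<^esub> s \<otimes>\<^bsub>SEM \<Omega>\<^esub> sem_const \<Omega> (qcnj \<delta>))"

definition sem_rho :: "quat set \<Rightarrow> sem \<Rightarrow> quat \<Rightarrow> sem"
  where "sem_rho \<Omega> f \<delta> = (THE r. sem_idempotent \<Omega> r \<and>
    f = sem_const \<Omega> 2 \<otimes>\<^bsub>SEM \<Omega>\<^esub> sem_re \<Omega> (f \<otimes>\<^bsub>SEM \<Omega>\<^esub> sem_const \<Omega> \<delta>)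
          \<otimes>\<^bsub>SEM \<Omega>\<^esub> sem_const \<Omega> (qcnj \<delta>) \<otimes>\<^bsub>SEM \<Omega>\<^esub> r)"

definition sem_isomorphism :: "quat set \<Rightarrow> (sem \<Rightarrow> sem) \<Rightarrow> bool"
  where "sem_isomorphism \<Omega> L \<longleftrightarrow> L \<in> iso (add_monoid (SEM \<Omega>)) (add_monoid (SEM \<Omega>)) \<and>
    (\<forall>a \<in> carrier (SEM_R \<Omega>). \<forall>x \<in> carrier (SEM \<Omega>).
      L (a \<otimes>\<^bsub>SEM \<Omega>\<^esub> x) = a \<otimes>\<^bsub>SEM \<Omega>\<^esub> L x)"

definition sem_L :: "quat set \<Rightarrow> sem \<Rightarrow> sem \<Rightarrow> sem \<Rightarrow> sem"
  where "sem_L \<Omega> f g \<phi> = f \<otimes>\<^bsub>SEM \<Omega>\<^esub> \<phi> \<otimes>\<^bsub>SEM \<Omega>\<^esub> g"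

end

theory Submission
  imports Defs "HOL-Complex_Analysis.Meromorphic"
begin

text \<open>
Everything is transported to the complexified quaternions \<open>\<complex> \<otimes> \<H>\<close>, here called biquaternions.  On a
circular open set a slice function \<open>f(x + Iy) = F\<^sub>1(x, y) + I F\<^sub>2(x, y)\<close> is the same thing as its
stem \<open>F\<^sub>1 + i F\<^sub>2\<close>, a biquaternion-valued function of \<open>z = x + iy\<close> that takes conjugate values at
conjugate points.  Three facts make this translation effective.  First, the condition
\<open>\<partial>\<^sub>x f + I \<partial>\<^sub>y f = 0\<close> on the slices is the Cauchy-Riemann system for the four complex coordinates of
the stem, so slice regular functions have holomorphic stems and semi-regular functions have
meromorphic ones (\<open>stem_analytic\<close>, \<open>stem_of_mero\<close>); conversely every symmetric meromorphic stem
comes from a semi-regular function (\<open>ex_semi_regular_representing\<close>).  Secondly, two semi-regular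
functions are identified exactly if their stems agree outside a sparse set (\<open>sem_rel_iff\<close>).
Thirdly, the stem of \<open>f * g\<close> is the pointwise product of the stems (\<open>star_fun_at_unit\<close>), because
conjugating \<open>q = x + Iy\<close> by \<open>f(q)\<close> only replaces \<open>I\<close> by another imaginary unit.

Hence the algebra of semi-regular functions is the algebra of symmetric meromorphic biquaternion
functions modulo equality almost everywhere, its slice preserving elements are the scalar ones,
\<open>f\<^sub>0\<close> is the scalar coordinate, and \<open>f\<^sup>s\<close> is the multiplicative biquaternion norm.  Connectedness of
\<open>\<Omega>\<close> enters through one dichotomy: a symmetric meromorphic scalar on the shadow of \<open>\<Omega>\<close> vanishes
almost everywhere or almost nowhere (\<open>mero_dichotomy\<close>).

The theorem then becomes pointwise linear algebra.  Let \<open>a\<close> and \<open>b\<close> be the stems of \<open>f\<close> and \<open>g\<close>.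
If \<open>f\<close> is a zero divisor, the scalar \<open>(f\<eta>)\<^sub>0\<close> is invertible and \<open>\<rho>\<^sub>f\<close> is the class of \<open>c \<eta> a\<close> with a
scalar \<open>c\<close> vanishing almost nowhere, so that \<open>\<rho>\<^sub>f\<close> and \<open>f\<close> have the same right annihilator; in the
same way \<open>\<sigma>\<^sub>g\<close> and \<open>g\<close> have the same left annihilator.  If \<open>g\<close> is not a zero divisor, its norm
vanishes almost nowhere, and multiplication by \<open>b\<close> can be cancelled.  Each of the three cases is
obtained by replacing or cancelling the two factors of \<open>a x b = 0\<close> accordingly.
\<close>

section \<open>Quaternions and their slices\<close>

lemmas quat_arith = plus_quat_def uminus_quat_def minus_quat_def times_quat_def scaleR_quat_def
  zero_quat_def one_quat_def

lemma of_real_quat: "of_real r = Quat r 0 0 0"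
  by (simp add: of_real_def quat_arith)

lemma norm_quat: "norm (q :: quat) = sqrt ((qre q)\<^sup>2 + (qim1 q)\<^sup>2 + (qim2 q)\<^sup>2 + (qim3 q)\<^sup>2)"
  by (simp add: norm_quat_def inner_quat_def power2_eq_square)

lemma bounded_linear_quat_coordinates:
  "bounded_linear qre" "bounded_linear qim1" "bounded_linear qim2" "bounded_linear qim3"
proof -
  have *: "bounded_linear (\<lambda>q :: quat. q \<bullet> c)" for c
    by (rule bounded_linear_inner_left)
  show "bounded_linear qre" "bounded_linear qim1" "bounded_linear qim2" "bounded_linear qim3"
    using *[of "Quat 1 0 0 0"] *[of "Quat 0 1 0 0"] *[of "Quat 0 0 1 0"] *[of "Quat 0 0 0 1"]
    by (simp_all add: inner_quat_def)
qed

lemma imag_units_iff: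
  "I \<in> \<S> \<longleftrightarrow> qre I = 0 \<and> (qim1 I)\<^sup>2 + (qim2 I)\<^sup>2 + (qim3 I)\<^sup>2 = 1" (is "_ \<longleftrightarrow> ?R")
proof
  assume "I \<in> \<S>"
  then have e: "qre I * qre I - qim1 I * qim1 I - qim2 I * qim2 I - qim3 I * qim3 I = -1"
     "2 * qre I * qim1 I = 0" "2 * qre I * qim2 I = 0" "2 * qre I * qim3 I = 0"
    by (auto simp: imag_units_def power2_eq_square quat_eq_iff quat_arith)
  have "qre I = 0"
  proof (rule ccontr)
    assume "qre I \<noteq> 0"
    with e have "qre I * qre I = -1" by simp
    then show False using zero_le_square[of "qre I"] by linarith
  qed
  with e show ?R by (simp add: power2_eq_square)
next
  assume ?R
  then show "I \<in> \<S>"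
    by (simp add: imag_units_def power2_eq_square quat_eq_iff quat_arith algebra_simps)
qed

lemma imag_unit_square: "I \<in> \<S> \<Longrightarrow> I * I = - 1"
  by (simp add: imag_units_def power2_eq_square)

lemma imag_unit_square_left: "I \<in> \<S> \<Longrightarrow> I * (I * q) = - q"
  by (metis imag_unit_square mult.assoc mult_minus1)

lemma uminus_imag_unit [simp]: "- I \<in> \<S> \<longleftrightarrow> I \<in> \<S>"
  by (simp add: imag_units_def)

lemma quat_units [simp]: "quat_i \<in> \<S>" "quat_j \<in> \<S>"
  by (simp_all add: imag_units_iff quat_i_def quat_j_def)

text \<open>
This is why the argument \<open>f(q)\<^sup>-\<^sup>1 q f(q)\<close> in the star product stays on the sphere of \<open>q\<close>.
\<close>
lemma imag_unit_conjugate: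
  assumes "I \<in> \<S>" "v \<noteq> 0"
  shows "inverse v * I * v \<in> \<S>"
proof -
  have "(inverse v * I * v) * (inverse v * I * v) = inverse v * I * (v * inverse v) * I * v"
    by (simp add: mult.assoc)
  also have "\<dots> = inverse v * (I * I) * v"
    using assms by (simp add: mult.assoc)
  also have "\<dots> = - 1"
    using assms by (simp add: imag_unit_square)
  finally show ?thesis
    by (simp add: imag_units_def power2_eq_square)
qed

text \<open>
The point \<open>x + Iy\<close> of the slice of \<open>I\<close>, with \<open>x + iy\<close> packed into one complex number so that
complex analysis can be applied to the slice variable.
\<close>
definition slice_point :: "quat \<Rightarrow> complex \<Rightarrow> quat"
  where "slice_point I z = slice_pt I (Re z) (Im z)"

lemma slice_point_Complex [simp]: "slice_point I (Complex x y) = slice_pt I x y"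
  by (simp add: slice_point_def)

lemma slice_point_uminus: "slice_point (- I) z = slice_point I (cnj z)"
  by (simp add: slice_point_def)

lemma slice_point_quat: "slice_point I z =
   Quat (Re z + qre I * Im z) (qim1 I * Im z) (qim2 I * Im z) (qim3 I * Im z)"
  by (simp add: slice_point_def of_real_quat quat_arith)

lemma norm_slice_point:
  assumes "I \<in> \<S>"
  shows "norm (slice_point I z) = cmod z"
proof -
  have q: "qre I = 0" and n: "(qim1 I)\<^sup>2 + (qim2 I)\<^sup>2 + (qim3 I)\<^sup>2 = 1"
    using assms by (auto simp: imag_units_iff)
  have "(qim1 I * Im z)\<^sup>2 + (qim2 I * Im z)\<^sup>2 + (qim3 I * Im z)\<^sup>2
      = ((qim1 I)\<^sup>2 + (qim2 I)\<^sup>2 + (qim3 I)\<^sup>2) * (Im z)\<^sup>2"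
    by (simp add: algebra_simps)
  with q n show ?thesis
    by (simp add: slice_point_quat norm_quat cmod_def add.assoc)
qed

lemma slice_plane_range: "slice_plane I = range (slice_point I)"
proof -
  have "slice_pt I x y \<in> range (slice_point I)" for x y
    by (metis slice_point_Complex rangeI)
  then show ?thesis by (auto simp: slice_plane_def slice_point_def)
qed

text \<open>
A point of the closed upper half plane that names the sphere of \<open>q\<close>: the circular sets are exactly
the unions of fibres of this map.
\<close>
definition profile :: "quat \<Rightarrow> complex"
  where "profile q = Complex (qre q) (norm (q - of_real (qre q)))"

lemma continuous_on_profile: "continuous_on A profile"
  unfolding profile_def Complex_eq
  by (intro continuous_intros bounded_linear.continuous_on[OF bounded_linear_quat_coordinates(1)])

lemma continuous_on_slice_point: "continuous_on A (slice_point I)"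
  unfolding slice_point_def by (intro continuous_intros)

lemma profile_slice_point:
  assumes "I \<in> \<S>"
  shows "profile (slice_point I z) = Complex (Re z) \<bar>Im z\<bar>"
proof -
  have q: "qre I = 0" and n: "(qim1 I)\<^sup>2 + (qim2 I)\<^sup>2 + (qim3 I)\<^sup>2 = 1"
    using assms by (auto simp: imag_units_iff)
  have "(qim1 I * Im z)\<^sup>2 + (qim2 I * Im z)\<^sup>2 + (qim3 I * Im z)\<^sup>2
      = ((qim1 I)\<^sup>2 + (qim2 I)\<^sup>2 + (qim3 I)\<^sup>2) * (Im z)\<^sup>2"
    by (simp add: algebra_simps)
  with q n show ?thesis
    by (simp add: profile_def slice_point_quat norm_quat of_real_quat quat_arith)
qed

lemma slice_point_profile:
  obtains I where "I \<in> \<S>" "q = slice_point I (profile q)"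
proof (cases "q = of_real (qre q)")
  case True
  then have "q = slice_point quat_i (profile q)"
    by (simp add: profile_def)
  then show ?thesis using that quat_units by blast
next
  case False
  define v where "v = q - of_real (qre q)"
  have v: "qre v = 0" "v \<noteq> 0"
    using False by (auto simp: v_def of_real_quat quat_arith quat_eq_iff)
  have n: "(norm v)\<^sup>2 = (qim1 v)\<^sup>2 + (qim2 v)\<^sup>2 + (qim3 v)\<^sup>2"
    by (simp add: norm_quat v)
  have "(inverse (norm v))\<^sup>2 * ((qim1 v)\<^sup>2 + (qim2 v)\<^sup>2 + (qim3 v)\<^sup>2) = 1"
    unfolding n[symmetric] using v by (simp flip: power_mult_distrib)
  then have "v /\<^sub>R norm v \<in> \<S>"
    using v by (simp add: imag_units_iff scaleR_quat_def power_mult_distrib distrib_left)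
  moreover have "slice_point (v /\<^sub>R norm v) (profile q) = q"
    using v by (simp add: profile_def flip: v_def) (simp add: v_def of_real_def)
  ultimately show ?thesis using that by metis
qed

text \<open>
Taking the \<open>profile\<close> of two representations \<open>x + Iy\<close> of the same quaternion shows that they differ
at most by the sign of \<open>y\<close>, which is absorbed by the sign of the unit.
\<close>
lemma quat_sphere_slice_point:
  assumes "I \<in> \<S>"
  shows "quat_sphere (slice_point I z) = (\<lambda>J. slice_point J z) ` \<S>"
proof
  show "(\<lambda>J. slice_point J z) ` \<S> \<subseteq> quat_sphere (slice_point I z)"
    using assms by (auto simp: quat_sphere_def slice_point_def)
next
  show "quat_sphere (slice_point I z) \<subseteq> (\<lambda>J. slice_point J z) ` \<S>"
  proof
    fix q assume "q \<in> quat_sphere (slice_point I z)"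
    then obtain I' J w where *: "I' \<in> \<S>" "J \<in> \<S>" "slice_point I z = slice_point I' w"
      and q: "q = slice_point J w"
      unfolding quat_sphere_def by (auto simp flip: slice_point_Complex)
    have "Complex (Re z) \<bar>Im z\<bar> = Complex (Re w) \<bar>Im w\<bar>"
      using * assms profile_slice_point by metis
    then have "w = z \<or> w = cnj z"
      by (auto simp: complex_eq_iff abs_if split: if_splits)
    then show "q \<in> (\<lambda>J. slice_point J z) ` \<S>"
      using q * slice_point_uminus[of J z] by (metis image_eqI uminus_imag_unit)
  qed
qed

lemma profile_eq_iff_sphere: "profile p = profile q \<longleftrightarrow> p \<in> quat_sphere q"
proof -
  obtain I where I: "I \<in> \<S>" "q = slice_point I (profile q)" by (rule slice_point_profile)
  obtain J where J: "J \<in> \<S>" "p = slice_point J (profile p)" by (rule slice_point_profile)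
  have pp: "profile q = Complex (Re (profile q)) \<bar>Im (profile q)\<bar>"
    by (simp add: profile_def)
  have S: "quat_sphere q = (\<lambda>J. slice_point J (profile q)) ` \<S>"
    using quat_sphere_slice_point[OF I(1), of "profile q"] I(2) by simp
  show ?thesis
  proof
    assume "profile p = profile q"
    with J S show "p \<in> quat_sphere q" by auto
  next
    assume "p \<in> quat_sphere q"
    then obtain K where "K \<in> \<S>" "p = slice_point K (profile q)" using S by auto
    with pp show "profile p = profile q" using profile_slice_point by simp
  qed
qed

lemma slice_point_in_sphere:
  assumes "I \<in> \<S>" "J \<in> \<S>"
  shows "slice_point I w \<in> quat_sphere (slice_point J z) \<longleftrightarrow> w = z \<or> w = cnj z"
  unfolding profile_eq_iff_sphere[symmetric] profile_slice_point[OF assms(1)]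
    profile_slice_point[OF assms(2)]
  by (auto simp: complex_eq_iff abs_if)

text \<open>
For circular \<open>W\<close> the unit \<open>i\<close> in this definition may be replaced by any other imaginary unit, so the
shadow is the common shape of all slices of \<open>W\<close>.
\<close>
definition shadow :: "quat set \<Rightarrow> complex set"
  where "shadow W = {z. slice_point quat_i z \<in> W}"

lemma slice_point_in_circular:
  assumes "circular W" "I \<in> \<S>"
  shows "slice_point I z \<in> W \<longleftrightarrow> z \<in> shadow W"
proof -
  have "slice_point J z \<in> W" if "slice_point K z \<in> W" "J \<in> \<S>" "K \<in> \<S>" for J K
    using assms(1) that quat_sphere_slice_point[of K z] unfolding circular_def by blast
  then show ?thesis using assms(2) quat_units by (auto simp: shadow_def)
qed

lemma cnj_in_shadow:
  assumes "circular W"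
  shows "cnj z \<in> shadow W \<longleftrightarrow> z \<in> shadow W"
  using slice_point_in_circular[OF assms, of "- quat_i" z]
  by (simp add: slice_point_uminus shadow_def)

lemma profile_in_shadow:
  assumes "circular W"
  shows "profile q \<in> shadow W \<longleftrightarrow> q \<in> W"
  by (metis assms slice_point_in_circular slice_point_profile)

lemma open_shadow: "open W \<Longrightarrow> open (shadow W)"
  unfolding shadow_def vimage_def[symmetric]
  by (intro open_vimage continuous_on_slice_point)

lemma shadow_mono: "W \<subseteq> V \<Longrightarrow> shadow W \<subseteq> shadow V"
  by (auto simp: shadow_def)

lemma shadow_Int: "shadow (V \<inter> W) = shadow V \<inter> shadow W"
  by (auto simp: shadow_def)

lemma circular_Int: "circular V \<Longrightarrow> circular W \<Longrightarrow> circular (V \<inter> W)"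
  by (auto simp: circular_def)

lemma circular_vimage_profile: "circular (profile -` A)"
  using profile_eq_iff_sphere unfolding circular_def by fastforce

section \<open>Biquaternions\<close>

text \<open>
The algebra \<open>\<complex> \<otimes> \<H>\<close> with respect to the basis \<open>1, i, j, k\<close>.  The complex imaginary unit is central
and different from the quaternion \<open>i\<close>.
\<close>
datatype biquat = Biquat (b0: complex) (b1: complex) (b2: complex) (b3: complex)

lemma biquat_eq_iff:
  "a = b \<longleftrightarrow> b0 a = b0 b \<and> b1 a = b1 b \<and> b2 a = b2 b \<and> b3 a = b3 b"
  by (auto intro: biquat.expand)

instantiation biquat :: ring_1
begin

definition "0 = Biquat 0 0 0 0"
definition "1 = Biquat 1 0 0 0"
definition "a + b = Biquat (b0 a + b0 b) (b1 a + b1 b) (b2 a + b2 b) (b3 a + b3 b)"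
definition "- a = Biquat (- b0 a) (- b1 a) (- b2 a) (- b3 a)"
definition "a - b = Biquat (b0 a - b0 b) (b1 a - b1 b) (b2 a - b2 b) (b3 a - b3 b)"
definition "a * b = Biquat
  (b0 a * b0 b - b1 a * b1 b - b2 a * b2 b - b3 a * b3 b)
  (b0 a * b1 b + b1 a * b0 b + b2 a * b3 b - b3 a * b2 b)
  (b0 a * b2 b - b1 a * b3 b + b2 a * b0 b + b3 a * b1 b)
  (b0 a * b3 b + b1 a * b2 b - b2 a * b1 b + b3 a * b0 b)"

instance
  by standard
    (simp_all add: biquat_eq_iff zero_biquat_def one_biquat_def plus_biquat_def
      uminus_biquat_def minus_biquat_def times_biquat_def algebra_simps)

end

lemmas biquat_arith = zero_biquat_def one_biquat_def plus_biquat_def uminus_biquat_def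
  minus_biquat_def times_biquat_def

definition bscalar :: "complex \<Rightarrow> biquat"
  where "bscalar c = Biquat c 0 0 0"

definition bquat :: "quat \<Rightarrow> biquat"
  where "bquat q = Biquat (of_real (qre q)) (of_real (qim1 q)) (of_real (qim2 q)) (of_real (qim3 q))"

text \<open>
Conjugation of the complex scalars; \<open>bcnj\<close> below is the quaternionic one.  The two commute.
\<close>
definition bbar :: "biquat \<Rightarrow> biquat"
  where "bbar a = Biquat (cnj (b0 a)) (cnj (b1 a)) (cnj (b2 a)) (cnj (b3 a))"

definition bcnj :: "biquat \<Rightarrow> biquat"
  where "bcnj a = Biquat (b0 a) (- b1 a) (- b2 a) (- b3 a)"

text \<open>
The complexified quaternion norm.  It is multiplicative but not definite: its nonzero null vectors
are the zero divisors of the algebra.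
\<close>
definition bnorm :: "biquat \<Rightarrow> complex"
  where "bnorm a = (b0 a)\<^sup>2 + (b1 a)\<^sup>2 + (b2 a)\<^sup>2 + (b3 a)\<^sup>2"

lemma bscalar_0 [simp]: "bscalar 0 = 0" and bscalar_1 [simp]: "bscalar 1 = 1"
  by (simp_all add: bscalar_def biquat_arith)

lemma bscalar_eq_iff [simp]: "bscalar c = bscalar d \<longleftrightarrow> c = d"
  by (simp add: bscalar_def)

lemma bscalar_eq_0_iff [simp]: "bscalar c = 0 \<longleftrightarrow> c = 0"
  by (simp add: bscalar_def biquat_arith)

lemma bscalar_mult: "bscalar c * bscalar d = bscalar (c * d)"
  by (simp add: bscalar_def biquat_arith)

lemma bscalar_central: "a * bscalar c = bscalar c * a"
  by (simp add: bscalar_def biquat_arith)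

lemma bscalar_mult_eq_0_iff: "c \<noteq> 0 \<Longrightarrow> bscalar c * a = 0 \<longleftrightarrow> a = 0"
  by (auto simp: bscalar_def biquat_arith biquat_eq_iff)

lemma bquat_0: "bquat 0 = 0" and bquat_1: "bquat 1 = 1" and bquat_2: "bquat 2 = bscalar 2"
proof -
  have two: "(2 :: quat) = Quat 2 0 0 0"
    using of_real_quat[of 2] by simp
  show "bquat 2 = bscalar 2"
    unfolding bquat_def bscalar_def two by simp
qed (simp_all add: bquat_def quat_arith biquat_arith)

lemma bquat_unitary:
  assumes "norm q = 1"
  shows "bquat q * bquat (qcnj q) = 1" "bquat (qcnj q) * bquat q = 1"
proof -
  have "(qre q)\<^sup>2 + (qim1 q)\<^sup>2 + (qim2 q)\<^sup>2 + (qim3 q)\<^sup>2 = 1"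
    using assms by (simp add: norm_quat)
  then have "of_real ((qre q)\<^sup>2 + (qim1 q)\<^sup>2 + (qim2 q)\<^sup>2 + (qim3 q)\<^sup>2) = (1 :: complex)"
    by simp
  then show "bquat q * bquat (qcnj q) = 1" "bquat (qcnj q) * bquat q = 1"
    by (simp_all add: bquat_def qcnj_def biquat_arith power2_eq_square algebra_simps)
qed

lemma bquat_mult_eq_0_iff:
  assumes "norm q = 1"
  shows "bquat q * a = 0 \<longleftrightarrow> a = 0" "a * bquat q = 0 \<longleftrightarrow> a = 0"
proof -
  have "bquat (qcnj q) * (bquat q * a) = a" "a * bquat q * bquat (qcnj q) = a"
    using bquat_unitary[OF assms] by (simp_all add: mult.assoc flip: mult.assoc[of "bquat (qcnj q)"])
  then show "bquat q * a = 0 \<longleftrightarrow> a = 0" "a * bquat q = 0 \<longleftrightarrow> a = 0"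
    by (metis mult_zero_right, metis mult_zero_left)
qed

text \<open>
Used with \<open>d = 2 (f\<eta>)\<^sub>0\<close>: at almost every point, the equation defining \<open>\<rho>\<^sub>f\<close> has exactly one
solution.
\<close>
lemma solve_unitary_left:
  assumes "d \<noteq> 0" "norm q = 1"
  shows "x = bscalar d * (bquat (qcnj q) * s) \<longleftrightarrow> s = bscalar (inverse d) * (bquat q * x)"
proof -
  have comm: "bquat p * (bscalar c * b) = bscalar c * (bquat p * b)" for p b c
    by (metis bscalar_central mult.assoc)
  have cancel: "bscalar c * (bscalar e * b) = bscalar (c * e) * b" for b c e
    by (metis bscalar_mult mult.assoc)
  have unit: "bquat q * (bquat (qcnj q) * b) = b" "bquat (qcnj q) * (bquat q * b) = b" for b
    by (simp_all add: bquat_unitary[OF assms(2)] flip: mult.assoc)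
  show ?thesis using assms(1) by (auto simp: comm cancel unit)
qed

lemma solve_unitary_right:
  assumes "d \<noteq> 0" "norm q = 1"
  shows "x = bscalar d * (s * bquat (qcnj q)) \<longleftrightarrow> s = bscalar (inverse d) * (x * bquat q)"
proof -
  have cancel: "bscalar c * (bscalar e * b) = bscalar (c * e) * b" for b c e
    by (metis bscalar_mult mult.assoc)
  show ?thesis
    using assms(1) by (auto simp: cancel mult.assoc bquat_unitary[OF assms(2)])
qed

lemma bnorm_mult: "bnorm (a * b) = bnorm a * bnorm b"
  by (simp add: bnorm_def biquat_arith power2_eq_square algebra_simps)

lemma mult_bcnj: "a * bcnj a = bscalar (bnorm a)"
  by (simp add: bcnj_def bscalar_def bnorm_def biquat_arith power2_eq_square)

lemma bcnj_mult: "bcnj a * a = bscalar (bnorm a)"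
  by (simp add: bcnj_def bscalar_def bnorm_def biquat_arith power2_eq_square)

text \<open>
The quaternionic conjugate divided by the norm is a two-sided inverse.
\<close>
lemma mult_bnorm_nonzero_eq_0_iff:
  assumes "bnorm b \<noteq> 0"
  shows "a * b = 0 \<longleftrightarrow> a = 0" "b * a = 0 \<longleftrightarrow> a = 0"
proof -
  have "a * b * bcnj b = bscalar (bnorm b) * a"
    by (simp add: mult.assoc mult_bcnj bscalar_central)
  then show "a * b = 0 \<longleftrightarrow> a = 0"
    using bscalar_mult_eq_0_iff[OF assms] by (metis mult_zero_left)
  have "bcnj b * b * a = bscalar (bnorm b) * a"
    by (simp add: bcnj_mult)
  then show "b * a = 0 \<longleftrightarrow> a = 0"
    using bscalar_mult_eq_0_iff[OF assms] by (metis mult_zero_right mult.assoc)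
qed

lemma b0_commute: "b0 (a * b) = b0 (b * a)"
  by (simp add: biquat_arith)

text \<open>
The Cayley-Hamilton relation for the reduced trace \<open>2 b\<^sub>0\<close> and the reduced norm.
\<close>
lemma biquat_square: "a * a = bscalar (2 * b0 a) * a - bscalar (bnorm a)"
  by (simp add: bscalar_def bnorm_def biquat_arith power2_eq_square)

text \<open>
For an element of norm zero the Cayley-Hamilton relation reads \<open>u\<^sup>2 = 2 u\<^sub>0 u\<close>; dividing by the trace
turns it into idempotency.
\<close>
lemma norm_zero_idempotent:
  assumes "bnorm u = 0" "b0 u \<noteq> 0"
  defines "r \<equiv> bscalar (inverse (2 * b0 u)) * u"
  shows "r * r = r"
proof -
  have "r * r = bscalar (inverse (2 * b0 u)) * (bscalar (inverse (2 * b0 u)) * (u * u))"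
    unfolding r_def by (metis bscalar_central mult.assoc)
  also have "u * u = bscalar (2 * b0 u) * u"
    using biquat_square[of u] assms(1) by simp
  also have "bscalar (inverse (2 * b0 u)) * (bscalar (2 * b0 u) * u) = u"
    using assms(2) by (simp add: bscalar_mult flip: mult.assoc)
  finally show ?thesis by (simp add: r_def)
qed

lemma bbar_mult: "bbar (a * b) = bbar a * bbar b"
  and bbar_add: "bbar (a + b) = bbar a + bbar b"
  and bbar_uminus: "bbar (- a) = - bbar a"
  and bbar_bcnj: "bbar (bcnj a) = bcnj (bbar a)"
  and bbar_bscalar: "bbar (bscalar c) = bscalar (cnj c)"
  and bbar_bquat: "bbar (bquat q) = bquat q"
  by (simp_all add: bbar_def bcnj_def bscalar_def bquat_def biquat_arith)

section \<open>Values of a biquaternion at imaginary units\<close>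

definition breal :: "biquat \<Rightarrow> quat"
  where "breal a = Quat (Re (b0 a)) (Re (b1 a)) (Re (b2 a)) (Re (b3 a))"

definition bimag :: "biquat \<Rightarrow> quat"
  where "bimag a = Quat (Im (b0 a)) (Im (b1 a)) (Im (b2 a)) (Im (b3 a))"

definition bjoin :: "quat \<Rightarrow> quat \<Rightarrow> biquat"
  where "bjoin p q = Biquat (Complex (qre p) (qre q)) (Complex (qim1 p) (qim1 q))
    (Complex (qim2 p) (qim2 q)) (Complex (qim3 p) (qim3 q))"

lemma bjoin_simps [simp]: "breal (bjoin p q) = p" "bimag (bjoin p q) = q"
    "bjoin (breal a) (bimag a) = a"
  by (simp_all add: breal_def bimag_def bjoin_def)

lemma biquat_eq_iff_parts: "a = b \<longleftrightarrow> breal a = breal b \<and> bimag a = bimag b"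
  by (metis bjoin_simps(3))

lemma breal_mult: "breal (a * b) = breal a * breal b - bimag a * bimag b"
  and bimag_mult: "bimag (a * b) = breal a * bimag b + bimag a * breal b"
  by (simp_all add: breal_def bimag_def biquat_arith quat_arith algebra_simps)

lemma breal_add: "breal (a + b) = breal a + breal b"
  and bimag_add: "bimag (a + b) = bimag a + bimag b"
  by (simp_all add: breal_def bimag_def biquat_arith quat_arith)

lemma breal_bbar: "breal (bbar a) = breal a" and bimag_bbar: "bimag (bbar a) = - bimag a"
  by (simp_all add: breal_def bimag_def bbar_def quat_arith)

text \<open>
Replacing the complex imaginary unit by \<open>I\<close>, placed on the left of the coefficients.  This recovers
the value of a slice function at \<open>x + Iy\<close> from its stem at \<open>x + iy\<close>.
\<close>
definition at_unit :: "quat \<Rightarrow> biquat \<Rightarrow> quat"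
  where "at_unit I a = breal a + I * bimag a"

lemma at_unit_add: "at_unit I (a + b) = at_unit I a + at_unit I b"
  by (simp add: at_unit_def breal_add bimag_add algebra_simps)

lemma at_unit_bbar: "at_unit (- I) (bbar a) = at_unit I a"
  by (simp add: at_unit_def breal_bbar bimag_bbar)

lemma at_unit_bquat: "at_unit I (bquat q) = q"
  by (simp add: at_unit_def breal_def bimag_def bquat_def quat_arith)

lemma at_unit_bscalar: "at_unit I (bscalar c) = slice_point I c"
  by (simp add: at_unit_def breal_def bimag_def bscalar_def slice_point_def of_real_quat quat_arith)

text \<open>
\<open>at_unit\<close> is not multiplicative, since \<open>I\<close> need not commute with the coefficients of the first
factor; the formula records the defect.
\<close>
lemma at_unit_mult:
  assumes "I \<in> \<S>"
  shows "at_unit I (a * b) = at_unit I a * breal b + I * at_unit I a * bimag b"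
  using imag_unit_square[OF assms]
  by (simp add: at_unit_def breal_mult bimag_mult algebra_simps imag_unit_square_left[OF assms])

lemma at_unit_mult_eq_0:
  assumes "I \<in> \<S>" "at_unit I a = 0"
  shows "at_unit I (a * b) = 0"
  by (simp add: at_unit_mult assms)

text \<open>
The defect is repaired by evaluating the second factor at the conjugated unit \<open>v\<^sup>-\<^sup>1 I v\<close>, because
\<open>v (v\<^sup>-\<^sup>1 I v) = I v\<close>.
\<close>
lemma at_unit_mult_conjugate:
  assumes "I \<in> \<S>" "at_unit I a \<noteq> 0"
  defines "v \<equiv> at_unit I a"
  shows "at_unit I (a * b) = v * at_unit (inverse v * I * v) b"
proof -
  have "v * (inverse v * I * v * bimag b) = (v * inverse v) * I * v * bimag b"
    by (simp only: mult.assoc)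
  then have "v * (inverse v * I * v * bimag b) = I * v * bimag b"
    using assms by simp
  then show ?thesis
    by (simp add: at_unit_mult[OF assms(1)] at_unit_def[of _ b] distrib_left flip: v_def)
qed

text \<open>
For scalars there is no defect, because they are evaluated inside the commutative plane of \<open>I\<close>.
\<close>
lemma at_unit_scalar_mult:
  assumes "I \<in> \<S>"
  shows "at_unit I (bscalar c * a) = slice_point I c * at_unit I a"
proof -
  have "I * slice_point I c = slice_point I c * I"
    by (simp add: slice_point_def of_real_quat quat_arith quat_eq_iff)
  then show ?thesis
    by (simp add: at_unit_mult[OF assms] at_unit_bscalar) (simp add: at_unit_def algebra_simps)
qed

lemma slice_point_mult:
  assumes "I \<in> \<S>"
  shows "slice_point I (a * b) = slice_point I a * slice_point I b"
  using at_unit_scalar_mult[OF assms, of a "bscalar b"]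
  by (simp add: bscalar_mult at_unit_bscalar)

lemma slice_point_power:
  assumes "I \<in> \<S>"
  shows "slice_point I (a ^ n) = slice_point I a ^ n"
proof (induction n)
  case 0
  show ?case by (simp add: slice_point_def)
qed (simp add: slice_point_mult[OF assms])

text \<open>
On every slice \<open>\<Delta>\<^sub>p\<close> is the real polynomial with zeros at the two points where the slice meets
the sphere of \<open>p\<close>.
\<close>
lemma Delta_slice_point:
  assumes "I \<in> \<S>" "J \<in> \<S>"
  shows "Delta (slice_point J z) (slice_point I w) = slice_point I ((w - z) * (w - cnj z))"
proof -
  have "(w - z) * (w - cnj z) = w * w - of_real (2 * Re z) * w + of_real ((cmod z)\<^sup>2)"
    by (simp add: complex_eq_iff cmod_power2 algebra_simps) (simp add: power2_eq_square)
  moreover have "slice_point I (a - b + c) = slice_point I a - slice_point I b + slice_point I c" for a b c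
    by (simp add: slice_point_def algebra_simps)
  moreover have "slice_point I (of_real r) = of_real r" for r
    by (simp add: slice_point_def)
  moreover have "qre (slice_point J z) = Re z"
    using assms(2) by (simp add: slice_point_quat imag_units_iff)
  ultimately show ?thesis
    by (simp only: Delta_def norm_slice_point[OF assms(2)] slice_point_mult[OF assms(1)] power2_eq_square)
qed

text \<open>
The star product of slice functions is the pointwise product of stems.  Where \<open>f\<close> vanishes, the
product of stems also has value zero at \<open>I\<close>, so the case distinction in \<open>star_fun\<close> does no harm.
\<close>
lemma star_fun_at_unit:
  assumes I: "I \<in> \<S>" and f: "f (slice_point I z) = at_unit I a"
    and g: "\<And>J. J \<in> \<S> \<Longrightarrow> g (slice_point J z) = at_unit J b"
  shows "star_fun f g (slice_point I z) = at_unit I (a * b)"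
proof (cases "at_unit I a = 0")
  case True
  then show ?thesis by (simp add: star_fun_def f at_unit_mult_eq_0[OF I])
next
  case False
  define v where "v = at_unit I a"
  have "inverse v * slice_point I z * v = inverse v * of_real (Re z) * v + inverse v * (I * of_real (Im z)) * v"
    by (simp add: slice_point_def distrib_left distrib_right)
  also have "inverse v * of_real (Re z) * v = of_real (Re z)"
    using False by (simp add: v_def of_real_def)
  also have "inverse v * (I * of_real (Im z)) * v = inverse v * I * v * of_real (Im z)"
    by (simp add: of_real_def)
  finally have "inverse v * slice_point I z * v = slice_point (inverse v * I * v) z"
    by (simp add: slice_point_def)
  moreover have "inverse v * I * v \<in> \<S>"
    using imag_unit_conjugate[OF I] False by (simp add: v_def)
  ultimately show ?thesis
    using False by (simp add: star_fun_def f g at_unit_mult_conjugate[OF I] flip: v_def)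
qed

text \<open>
Evaluation at \<open>\<plusminus>i\<close> removes the \<open>j\<close> and \<open>k\<close> coordinates of the real and the imaginary part, and
evaluation at \<open>\<plusminus>j\<close> removes the \<open>i\<close> coordinates.
\<close>
lemma slice_planes_imp_real:
  assumes "\<And>I. I \<in> \<S> \<Longrightarrow> at_unit I a \<in> slice_plane I"
  shows "a = bscalar (b0 a)"
proof -
  have "qim2 (at_unit I a) = 0 \<and> qim3 (at_unit I a) = 0" if "I = quat_i \<or> I = - quat_i" for I
  proof -
    have "I \<in> \<S>" using that by auto
    then obtain w where "at_unit I a = slice_point I w"
      using assms[of I] unfolding slice_plane_range by blast
    then show ?thesis using that by (auto simp: slice_point_quat quat_i_def quat_arith)
  qed
  then have i: "qim2 (at_unit quat_i a) = 0" "qim3 (at_unit quat_i a) = 0"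
    "qim2 (at_unit (- quat_i) a) = 0" "qim3 (at_unit (- quat_i) a) = 0" by simp_all
  have "qim1 (at_unit I a) = 0 \<and> qim3 (at_unit I a) = 0" if "I = quat_j \<or> I = - quat_j" for I
  proof -
    have "I \<in> \<S>" using that by auto
    then obtain w where "at_unit I a = slice_point I w"
      using assms[of I] unfolding slice_plane_range by blast
    then show ?thesis using that by (auto simp: slice_point_quat quat_j_def quat_arith)
  qed
  then have j: "qim1 (at_unit quat_j a) = 0" "qim3 (at_unit quat_j a) = 0"
    "qim1 (at_unit (- quat_j) a) = 0" "qim3 (at_unit (- quat_j) a) = 0" by simp_all
  show ?thesis
    using i j by (simp add: at_unit_def breal_def bimag_def quat_arith quat_i_def quat_j_def
      biquat_eq_iff complex_eq_iff bscalar_def)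
qed

section \<open>Slice regular functions and holomorphic stems\<close>

text \<open>
Holomorphy and meromorphy of biquaternion-valued functions are expressed by quantifying over these
four coordinates.
\<close>
definition bcoords :: "(biquat \<Rightarrow> complex) set"
  where "bcoords = {b0, b1, b2, b3}"

lemma bcoords_bbar: "c \<in> bcoords \<Longrightarrow> c (bbar a) = cnj (c a)"
  by (auto simp: bcoords_def bbar_def)

text \<open>
The stem is read off from the slice of the quaternion \<open>i\<close> alone: \<open>F\<^sub>1 = (f(z) + f(z\<^sup>c)) / 2\<close> and
\<open>F\<^sub>2 = - i (f(z) - f(z\<^sup>c)) / 2\<close>, where \<open>z\<close> and \<open>z\<^sup>c\<close> denote points of this slice.  With this choice it
is a total function, linear in \<open>f\<close> and symmetric everywhere, and its derivatives follow from those
of \<open>f\<close> on one slice.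
\<close>
definition stem :: "(quat \<Rightarrow> quat) \<Rightarrow> complex \<Rightarrow> biquat"
  where "stem f z = (let u = f (slice_point quat_i z); v = f (slice_point quat_i (cnj z))
     in bjoin ((1 / 2) *\<^sub>R (u + v)) ((1 / 2) *\<^sub>R (- quat_i * (u - v))))"

lemma stem_cnj: "stem f (cnj z) = bbar (stem f z)"
  by (simp add: stem_def Let_def biquat_eq_iff_parts breal_bbar bimag_bbar algebra_simps)

text \<open>
The values at \<open>i\<close> and \<open>- i\<close> already determine a biquaternion.
\<close>
lemma stem_eqI:
  assumes "\<And>I. I \<in> \<S> \<Longrightarrow> f (slice_point I z) = at_unit I a"
  shows "stem f z = a"
proof -
  have sum_difference: "u + v = 2 *\<^sub>R breal a \<and> - quat_i * (u - v) = 2 *\<^sub>R bimag a"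
    if "breal a + quat_i * bimag a = u" "breal a - quat_i * bimag a = v" for u v
    unfolding that[symmetric] using imag_unit_square_left[of quat_i "bimag a"]
    by (simp add: scaleR_2 algebra_simps)
  have "breal a + quat_i * bimag a = f (slice_point quat_i z)"
    "breal a - quat_i * bimag a = f (slice_point quat_i (cnj z))"
    using assms[of quat_i] assms[of "- quat_i"] by (simp_all add: at_unit_def slice_point_uminus)
  note e = sum_difference[OF this, THEN conjunct1] sum_difference[OF this, THEN conjunct2]
  show ?thesis
    unfolding stem_def Let_def biquat_eq_iff_parts bjoin_simps e by simp
qed

lemma slice_regular_representation:
  assumes "slice_regular_on W f" "z \<in> shadow W" "I \<in> \<S>"
  shows "f (slice_point I z) = at_unit I (stem f z)"
proof -
  have circ: "circular W" using assms(1) by (simp add: slice_regular_on_def)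
  obtain F1 F2 where F: "slice_pt J x y \<in> W \<Longrightarrow> f (slice_pt J x y) = F1 x y + J * F2 x y"
    if "J \<in> \<S>" for x y :: real and J
    using assms(1) unfolding slice_regular_on_def by blast
  define a where "a = bjoin (F1 (Re z) (Im z)) (F2 (Re z) (Im z))"
  have a: "f (slice_point J z) = at_unit J a" if "J \<in> \<S>" for J
    using F[OF that, of "Re z" "Im z"] slice_point_in_circular[OF circ that, of z] assms(2)
    by (simp add: a_def at_unit_def slice_point_def)
  have "stem f z = a"
    by (rule stem_eqI) (rule a)
  with a assms(3) show ?thesis by simp
qed

text \<open>
The equations \<open>\<partial>\<^sub>x f + I \<partial>\<^sub>y f = 0\<close> for \<open>I = i\<close> and \<open>I = - i\<close> are two linear combinations of the two
Cauchy-Riemann equations of \<open>F\<^sub>1 + i F\<^sub>2\<close>.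
\<close>
lemma stem_analytic:
  assumes "slice_regular_on W f" "z \<in> shadow W" "c \<in> bcoords"
  shows "(\<lambda>z. c (stem f z)) analytic_on {z}"
proof -
  have circ: "circular W" and op: "open W"
    using assms(1) by (simp_all add: slice_regular_on_def)
  have "(\<lambda>z. c (stem f z)) field_differentiable (at w)" if w: "w \<in> shadow W" for w
  proof -
    \<comment> \<open>The slice condition, restated for the derivative with respect to the complex variable.\<close>
    have deriv: "\<exists>D. ((\<lambda>z. f (slice_point J z)) has_derivative D) (at w) \<and>
        D 1 + J * D \<i> = 0" if J: "J \<in> \<S>" for J
    proof -
      have "slice_pt J (Re w) (Im w) \<in> W"
        using slice_point_in_circular[OF circ J, of w] w by (simp add: slice_point_def)
      with assms(1) J have "\<exists>D. ((\<lambda>(s, t). f (slice_pt J s t)) has_derivative D) (at (Re w, Im w)) \<and>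
          (1 / 2) *\<^sub>R (D (1, 0) + J * D (0, 1)) = 0"
        unfolding slice_regular_on_def by blast
      then obtain D where
        D: "((\<lambda>(s, t). f (slice_pt J s t)) has_derivative D) (at (Re w, Im w))"
          "D (1, 0) + J * D (0, 1) = 0"
        by auto
      have "((\<lambda>z. (Re z, Im z)) has_derivative (\<lambda>z. (Re z, Im z))) (at w)"
        by (auto intro!: derivative_eq_intros)
      from has_derivative_compose[OF this D(1)]
      have "((\<lambda>z. f (slice_point J z)) has_derivative (\<lambda>z. D (Re z, Im z))) (at w)"
        by (simp add: slice_point_def)
      with D(2) show ?thesis by auto
    qed
    define u where "u z = f (slice_point quat_i z)" for z
    define v where "v z = f (slice_point (- quat_i) z)" for z
    obtain U where U: "(u has_derivative U) (at w)" "U 1 = - (quat_i * U \<i>)"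
      using deriv[of quat_i] unfolding u_def by (auto simp: eq_neg_iff_add_eq_0)
    obtain V where V: "(v has_derivative V) (at w)" "V 1 = quat_i * V \<i>"
      using deriv[of "- quat_i"] unfolding v_def by auto
    define A where "A z = (1 / 2) *\<^sub>R (u z + v z)" for z
    define B where "B z = (1 / 2) *\<^sub>R (- quat_i * (u z - v z))" for z
    define DA where "DA z = (1 / 2) *\<^sub>R (U z + V z)" for z
    define DB where "DB z = (1 / 2) *\<^sub>R (- quat_i * (U z - V z))" for z
    have dA: "(A has_derivative DA) (at w)" and dB: "(B has_derivative DB) (at w)"
      unfolding A_def DA_def B_def DB_def by (intro derivative_intros U(1) V(1))+
    \<comment> \<open>The Cauchy-Riemann equations for the pair of derivatives of \<open>F\<^sub>1\<close> and \<open>F\<^sub>2\<close>.\<close>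
    have CR: "DA \<i> = - DB 1" "DB \<i> = DA 1"
      using imag_unit_square_left[of quat_i]
      by (simp_all add: DA_def DB_def U(2) V(2) algebra_simps)
    have coord: "(\<lambda>z. Complex (r (A z)) (r (B z))) field_differentiable (at w)"
      if r: "bounded_linear r" for r
    proof -
      have rA: "((\<lambda>z. r (A z)) has_derivative (\<lambda>z. r (DA z))) (at w)"
        and rB: "((\<lambda>z. r (B z)) has_derivative (\<lambda>z. r (DB z))) (at w)"
        using bounded_linear.has_derivative[OF r] dA dB by blast+
      have lin: "linear (\<lambda>z. r (DA z))" "linear (\<lambda>z. r (DB z))"
        using rA rB has_derivative_linear by blast+
      have split: "L z = Re z * L 1 + Im z * L \<i>" if "linear L" for L :: "complex \<Rightarrow> real" and z
      proof -
        have "L z = L (Re z *\<^sub>R 1 + Im z *\<^sub>R \<i>)"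
          by (rule arg_cong[of _ _ L]) (simp add: complex_eq_iff)
        then show ?thesis
          using linear_add[OF that] linear_scale[OF that] by simp
      qed
      have "r (- q) = - r q" for q
        using r linear_neg bounded_linear.linear by blast
      then have "Complex (r (DA z)) (r (DB z)) = Complex (r (DA 1)) (r (DB 1)) * z" for z
        using split[OF lin(1), of z] split[OF lin(2), of z]
        by (simp add: complex_eq_iff CR)
      then have "(\<lambda>z. Complex (r (DA z)) (r (DB z))) = (*) (Complex (r (DA 1)) (r (DB 1)))"
        by (rule ext)
      moreover have "((\<lambda>z. Complex (r (A z)) (r (B z))) has_derivative
          (\<lambda>z. Complex (r (DA z)) (r (DB z)))) (at w)"
        unfolding Complex_eq by (intro derivative_intros rA rB)
      ultimately have "((\<lambda>z. Complex (r (A z)) (r (B z))) has_field_derivative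
          Complex (r (DA 1)) (r (DB 1))) (at w)"
        unfolding has_field_derivative_def by metis
      then show ?thesis
        by (auto simp: field_differentiable_def)
    qed
    have "stem f = (\<lambda>z. bjoin (A z) (B z))"
      by (simp add: fun_eq_iff stem_def Let_def A_def B_def u_def v_def slice_point_uminus)
    then show ?thesis
      using assms(3) coord[OF bounded_linear_quat_coordinates(1)]
        coord[OF bounded_linear_quat_coordinates(2)] coord[OF bounded_linear_quat_coordinates(3)]
        coord[OF bounded_linear_quat_coordinates(4)]
      by (auto simp: bcoords_def bjoin_def)
  qed
  then have "(\<lambda>z. c (stem f z)) holomorphic_on shadow W"
    by (simp add: holomorphic_on_def field_differentiable_at_within)
  then show ?thesis
    using assms(2) op open_shadow analytic_at by blast
qed

text \<open>
The derivative of \<open>at_unit I (h z)\<close> is multiplication by the complex derivative \<open>e\<close> of the stem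
followed by evaluation at \<open>I\<close>; the differential condition holds since multiplication by the complex
unit becomes left multiplication by \<open>I\<close>.
\<close>
lemma slice_regular_onI:
  assumes "open W" "circular W"
    and rep: "\<And>I z. I \<in> \<S> \<Longrightarrow> z \<in> shadow W \<Longrightarrow> f (slice_point I z) = at_unit I (h z)"
    and sym: "\<And>z. h (cnj z) = bbar (h z)"
    and ana: "\<And>c z. c \<in> bcoords \<Longrightarrow> z \<in> shadow W \<Longrightarrow> (\<lambda>z. c (h z)) analytic_on {z}"
  shows "slice_regular_on W f"
proof -
  define F1 where "F1 x y = breal (h (Complex x y))" for x y
  define F2 where "F2 x y = bimag (h (Complex x y))" for x y
  have "F1 x (- y) = F1 x y" "F2 x (- y) = - F2 x y" for x y
    using sym[of "Complex x y"]
    by (simp_all add: F1_def F2_def breal_bbar bimag_bbar complex_cnj)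
  moreover have "f (slice_pt I x y) = F1 x y + I * F2 x y"
    if "I \<in> \<S>" "slice_pt I x y \<in> W" for I x y
    using rep[of I "Complex x y"] slice_point_in_circular[OF assms(2), of I "Complex x y"] that
    by (simp add: at_unit_def F1_def F2_def)
  moreover have "\<exists>D. ((\<lambda>(s, t). f (slice_pt I s t)) has_derivative D) (at (x, y)) \<and>
      (1 / 2) *\<^sub>R (D (1, 0) + I * D (0, 1)) = 0"
    if I: "I \<in> \<S>" and W: "slice_pt I x y \<in> W" for I x y
  proof -
    define w where "w = Complex x y"
    have w: "w \<in> shadow W"
      using slice_point_in_circular[OF assms(2) I, of w] W by (simp add: w_def)
    have "\<exists>d. ((\<lambda>z. c (h z)) has_field_derivative d) (at w)" if "c \<in> bcoords" for c
      using ana[OF that w] analytic_on_imp_differentiable_at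
      by (metis DERIV_deriv_iff_field_differentiable singletonI)
    then obtain d where d: "((\<lambda>z. c (h z)) has_field_derivative d c) (at w)" if "c \<in> bcoords" for c
      by metis
    define e where "e = Biquat (d b0) (d b1) (d b2) (d b3)"
    have pair: "((\<lambda>p. Complex (fst p) (snd p)) has_derivative (\<lambda>p. Complex (fst p) (snd p)))
        (at (x, y))"
      unfolding Complex_eq by (auto intro!: derivative_eq_intros)
    have part: "((\<lambda>p. c (h (Complex (fst p) (snd p)))) has_derivative
        (\<lambda>p. d c * Complex (fst p) (snd p))) (at (x, y))" if "c \<in> bcoords" for c
      using has_derivative_compose[OF pair, of "\<lambda>z. c (h z)" "\<lambda>z. d c * z"] d[OF that]
      by (simp add: has_field_derivative_def w_def)
    have Quat: "Quat p q r s = p *\<^sub>R 1 + q *\<^sub>R quat_i + r *\<^sub>R quat_j + s *\<^sub>R quat_k" for p q r s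
      by (simp add: quat_arith quat_i_def quat_j_def quat_k_def)
    have "((\<lambda>p. at_unit I (h (Complex (fst p) (snd p)))) has_derivative
        (\<lambda>p. at_unit I (bscalar (Complex (fst p) (snd p)) * e))) (at (x, y))"
      unfolding at_unit_def breal_def bimag_def Quat
      by (rule derivative_eq_intros part refl | simp add: bcoords_def)+
         (simp add: fun_eq_iff e_def bscalar_def biquat_arith algebra_simps)
    moreover have "open {p :: real \<times> real. Complex (fst p) (snd p) \<in> shadow W}"
    proof -
      have "continuous_on UNIV (\<lambda>p :: real \<times> real. Complex (fst p) (snd p))"
        unfolding Complex_eq by (intro continuous_intros)
      then show ?thesis
        using open_vimage[OF open_shadow[OF assms(1)]] by (simp add: vimage_def)
    qed
    ultimately have "((\<lambda>p. f (slice_pt I (fst p) (snd p))) has_derivative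
        (\<lambda>p. at_unit I (bscalar (Complex (fst p) (snd p)) * e))) (at (x, y))"
      by (rule has_derivative_transform_within_open)
         (use w I rep[of I] in \<open>auto simp: w_def simp flip: slice_point_Complex\<close>)
    moreover have "at_unit I (bscalar (Complex 1 0) * e) + I * at_unit I (bscalar (Complex 0 1) * e) = 0"
      using imag_unit_square_left[OF I] by (simp add: at_unit_scalar_mult[OF I])
    ultimately show ?thesis
      by (intro exI conjI) (auto simp: case_prod_unfold)
  qed
  ultimately show ?thesis
    using assms(1,2) unfolding slice_regular_on_def
    by (intro conjI exI[of _ F1] exI[of _ F2]) blast+
qed

text \<open>
The slice function with stem \<open>h\<close>.  At real points every imaginary unit qualifies for the choice, and
symmetry of \<open>h\<close> makes the value independent of it.
\<close>
definition induce :: "(complex \<Rightarrow> biquat) \<Rightarrow> quat \<Rightarrow> quat"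
  where "induce h q = at_unit (SOME I. I \<in> \<S> \<and> q = slice_point I (profile q)) (h (profile q))"

lemma induce_slice_point:
  assumes sym: "\<And>z. h (cnj z) = bbar (h z)" and I: "I \<in> \<S>"
  shows "induce h (slice_point I z) = at_unit I (h z)"
proof -
  define q where "q = slice_point I z"
  define J where "J = (SOME I. I \<in> \<S> \<and> q = slice_point I (profile q))"
  have "\<exists>I. I \<in> \<S> \<and> q = slice_point I (profile q)" using slice_point_profile by metis
  then have J: "J \<in> \<S>" "q = slice_point J (profile q)"
    unfolding J_def by (rule someI2_ex; simp)+
  have pq: "profile q = Complex (Re z) \<bar>Im z\<bar>" using I by (simp add: q_def profile_slice_point)
  consider "Im z = 0" | "Im z > 0" | "Im z < 0" by linarith
  then have "at_unit J (h (profile q)) = at_unit I (h z)"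
  proof cases
    case 1
    then have z: "profile q = z" "cnj z = z" by (simp_all add: pq complex_eq_iff)
    have "bimag (h z) = - bimag (h z)"
      using sym[of z] z(2) bimag_bbar by metis
    then have "2 *\<^sub>R bimag (h z) = 0" by (simp add: scaleR_2 eq_neg_iff_add_eq_0)
    then show ?thesis by (simp add: z at_unit_def)
  next
    case 2
    then have z: "profile q = z" by (simp add: pq complex_eq_iff)
    then have "I * of_real (Im z) = J * of_real (Im z)"
      using J(2) by (simp add: q_def slice_point_def)
    then show ?thesis using 2 z by simp
  next
    case 3
    then have z: "profile q = cnj z" by (simp add: pq complex_eq_iff)
    then have "(I + J) * of_real (Im z) = 0"
      using J(2) by (simp add: q_def slice_point_def distrib_right)
    then have "I + J = 0" using 3 by simp
    then have "J = - I" by (simp add: eq_neg_iff_add_eq_0 add.commute)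
    then show ?thesis by (simp add: z sym at_unit_bbar)
  qed
  then show ?thesis by (simp add: induce_def J_def flip: q_def)
qed

section \<open>Symmetric meromorphic functions\<close>

lemma filterlim_cnj_at: "filterlim cnj (at (cnj z)) (at z)"
proof (rule filterlim_atI)
  show "\<forall>\<^sub>F w in at z. cnj w \<noteq> cnj z"
    unfolding eventually_at_filter by (intro always_eventually) auto
qed (auto intro!: tendsto_eq_intros)

lemma tendsto_symmetric:
  assumes sym: "\<And>z. F (cnj z) = cnj (F z)" and "(F \<longlongrightarrow> l) (at z)"
  shows "(F \<longlongrightarrow> cnj l) (at (cnj z))"
proof -
  have "filterlim cnj (at z) (at (cnj z))"
    using filterlim_cnj_at[of "cnj z"] by simp
  from filterlim_compose[OF assms(2) this] have "((\<lambda>w. cnj (F (cnj w))) \<longlongrightarrow> cnj l) (at (cnj z))"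
    by (intro tendsto_intros)
  then show ?thesis by (simp add: sym)
qed

text \<open>
Clearing a pole by \<open>\<Delta>\<^sub>p\<close> leaves removable singularities, and the function with these values filled in
must again be a stem.
\<close>
lemma remove_sings_symmetric:
  assumes sym: "\<And>z. F (cnj z) = cnj (F z)"
  shows "remove_sings F (cnj z) = cnj (remove_sings F z)"
proof (cases "\<exists>l. F \<midarrow>z\<rightarrow> l")
  case True
  then show ?thesis using tendsto_symmetric[of F, OF sym] remove_sings_eqI by blast
next
  case False
  moreover from this have "\<nexists>l. F \<midarrow>cnj z\<rightarrow> l"
    using tendsto_symmetric[of F _ "cnj z", OF sym] by auto
  ultimately show ?thesis by (simp add: remove_sings_def)
qed

lemma analytic_symmetric:
  assumes sym: "\<And>z. F (cnj z) = cnj (F z)" and "F analytic_on {z}"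
  shows "F analytic_on {cnj z}"
proof -
  obtain S where S: "open S" "z \<in> S" "F holomorphic_on S"
    using assms(2) by (auto simp: analytic_at)
  have "open (cnj ` S)"
    unfolding image_cnj_conv_vimage_cnj using S by (intro open_vimage) (auto intro!: continuous_intros)
  moreover have "cnj \<circ> F \<circ> cnj holomorphic_on cnj ` S"
    using S(3) calculation by (intro holomorphic_on_compose_cnj_cnj) (auto simp: image_image)
  moreover have "cnj \<circ> F \<circ> cnj = F" by (simp add: fun_eq_iff sym)
  ultimately show ?thesis using S(2) by (auto simp: analytic_at)
qed

text \<open>
An eventual property at a point is inherited by all nearby points; this gives the open sets in the
identity principle below.
\<close>
lemma open_eventually_at: "open {z :: complex. eventually P (at z)}"
proof (subst open_subopen, intro ballI)
  fix z assume "z \<in> {z. eventually P (at z)}"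
  then obtain S where S: "open S" "z \<in> S" "\<And>w. w \<in> S \<Longrightarrow> w \<noteq> z \<Longrightarrow> P w"
    by (auto simp: eventually_at_topological)
  have "eventually P (at w)" if w: "w \<in> S" for w
  proof (cases "w = z")
    case False
    have "\<forall>\<^sub>F v in at w. v \<in> S - {z}"
      using S(1) w False by (intro eventually_at_in_open') auto
    then show ?thesis by eventually_elim (use S(3) in blast)
  qed (use S in \<open>auto simp: eventually_at_topological\<close>)
  with S show "\<exists>T. open T \<and> z \<in> T \<and> T \<subseteq> {z. eventually P (at z)}" by blast
qed

lemma eventually_iff_cong:
  "eventually (\<lambda>z. P z \<longleftrightarrow> Q z) F \<Longrightarrow> eventually P F \<longleftrightarrow> eventually Q F"
  by (rule eventually_cong) auto

lemma meromorphic_clear_denominator: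
  assumes "f meromorphic_on {z}"
  shows "\<exists>m l. ((\<lambda>w. (w - z) ^ m * f w) \<longlongrightarrow> l) (at z)"
proof -
  have iso: "isolated_singularity_at f z" and ess: "not_essential f z"
    using assms by (simp_all add: meromorphic_at_iff)
  show ?thesis
  proof (cases "is_pole f z")
    case False
    then obtain l where "(f \<longlongrightarrow> l) (at z)" using ess by (auto simp: not_essential_def)
    then have "((\<lambda>w. (w - z) ^ 0 * f w) \<longlongrightarrow> l) (at z)" by simp
    then show ?thesis by blast
  next
    case True
    obtain S where S: "open S" "z \<in> S" "f holomorphic_on S - {z}"
      using iso analytic_imp_holomorphic isolated_singularity_at_iff_analytic_nhd by auto
    define n where "n = nat (- zorder f z)"
    obtain r where r: "r > 0" "zor_poly f z holomorphic_on cball z r"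
      "\<forall>w\<in>cball z r - {z}. f w = zor_poly f z w / (w - z) ^ n"
      using zorder_exist_pole[OF S(3,1,2) True] by (auto simp: n_def)
    have "isCont (zor_poly f z) z"
      using r(1,2) holomorphic_on_imp_continuous_on[of _ "cball z r"]
      by (metis centre_in_ball continuous_on_interior interior_cball)
    then have "(zor_poly f z \<longlongrightarrow> zor_poly f z z) (at z)" by (simp add: isCont_def)
    moreover have "\<forall>\<^sub>F w in at z. zor_poly f z w = (w - z) ^ n * f w"
      using eventually_at_in_open[OF open_ball, of z z r] r(1)
      by (auto elim!: eventually_mono simp: r(3))
    ultimately have "((\<lambda>w. (w - z) ^ n * f w) \<longlongrightarrow> zor_poly f z z) (at z)"
      by (rule Lim_transform_eventually)
    then show ?thesis by blast
  qed
qed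

text \<open>
The sum of the exponents works for every coordinate at once.
\<close>
lemma clear_common_denominator:
  assumes "finite C" "\<And>c. c \<in> C \<Longrightarrow> (\<lambda>w. c (h w)) meromorphic_on {z :: complex}"
  shows "\<exists>m. \<forall>c\<in>C. \<exists>l. ((\<lambda>w. (w - z) ^ m * c (h w)) \<longlongrightarrow> l) (at z)"
proof -
  obtain m where m: "\<And>c. c \<in> C \<Longrightarrow> \<exists>l. ((\<lambda>w. (w - z) ^ m c * c (h w)) \<longlongrightarrow> l) (at z)"
    using meromorphic_clear_denominator[OF assms(2)] by metis
  have "\<exists>l. ((\<lambda>w. (w - z) ^ sum m C * c (h w)) \<longlongrightarrow> l) (at z)" if c: "c \<in> C" for c
  proof -
    obtain l where "((\<lambda>w. (w - z) ^ m c * c (h w)) \<longlongrightarrow> l) (at z)" using m[OF c] by blast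
    then have "((\<lambda>w. (w - z) ^ (sum m (C - {c})) * ((w - z) ^ m c * c (h w)))
        \<longlongrightarrow> (z - z) ^ (sum m (C - {c})) * l) (at z)"
      by (intro tendsto_intros)
    moreover have "sum m C = m c + sum m (C - {c})"
      using assms(1) c by (simp add: sum.remove)
    ultimately show ?thesis by (auto simp: power_add mult_ac)
  qed
  then show ?thesis by blast
qed

section \<open>Semi-regular functions and meromorphic stems\<close>

abbreviation stem_of :: "(quat \<rightharpoonup> quat) \<Rightarrow> complex \<Rightarrow> biquat"
  where "stem_of f \<equiv> stem (\<lambda>q. the (f q))"

lemma semi_regular_dom:
  assumes "f \<in> semi_regular \<Omega>"
  shows "open (dom f)" "circular (dom f)" "dom f \<subseteq> \<Omega>"
  using assms by (auto simp: semi_regular_def slice_regular_on_def)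

lemma semi_regular_rep:
  assumes "f \<in> semi_regular \<Omega>" "z \<in> shadow (dom f)" "I \<in> \<S>"
  shows "the (f (slice_point I z)) = at_unit I (stem_of f z)"
  using assms slice_regular_representation[of "dom f" "\<lambda>q. the (f q)"]
  by (simp add: semi_regular_def)

lemma semi_regular_analytic:
  assumes "f \<in> semi_regular \<Omega>" "z \<in> shadow (dom f)" "c \<in> bcoords"
  shows "(\<lambda>z. c (stem_of f z)) analytic_on {z}"
  using assms stem_analytic[of "dom f" "\<lambda>q. the (f q)"] by (simp add: semi_regular_def)

text \<open>
Symmetry is required on the whole plane, not just on the shadow: values outside the shadow
do not matter, and a global condition passes to sums, products and inverses without side
conditions.
\<close>
definition mero_stems :: "quat set \<Rightarrow> (complex \<Rightarrow> biquat) set"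
  where "mero_stems \<Omega> = {h. (\<forall>z. h (cnj z) = bbar (h z)) \<and>
    (\<forall>c\<in>bcoords. (\<lambda>z. c (h z)) meromorphic_on shadow \<Omega>)}"

lemma mero_stems_symmetric: "h \<in> mero_stems \<Omega> \<Longrightarrow> h (cnj z) = bbar (h z)"
  by (simp add: mero_stems_def)

lemma mero_stems_meromorphic:
  "h \<in> mero_stems \<Omega> \<Longrightarrow> c \<in> bcoords \<Longrightarrow> (\<lambda>z. c (h z)) meromorphic_on shadow \<Omega>"
  by (simp add: mero_stems_def)

text \<open>
A singular sphere meets a slice in one point and its conjugate, and singular spheres are isolated.
\<close>
lemma eventually_in_shadow_dom:
  assumes "f \<in> semi_regular \<Omega>" "z \<in> shadow \<Omega>"
  shows "\<forall>\<^sub>F w in at z. w \<in> shadow (dom f)"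
proof (cases "z \<in> shadow (dom f)")
  case True
  moreover have "open (shadow (dom f))"
    using assms(1) by (auto simp: semi_regular_def slice_regular_on_def intro: open_shadow)
  ultimately show ?thesis by (simp add: eventually_at_in_open')
next
  case False
  define p where "p = slice_point quat_i z"
  from False assms have "pole_or_removable f p"
    by (auto simp: p_def shadow_def semi_regular_def)
  then obtain U k m where U: "p \<in> U" "U - quat_sphere p \<subseteq> dom f" "slice_regular_on U k"
    "\<forall>q \<in> U - quat_sphere p. k q = Delta p q ^ m * the (f q)"
    unfolding pole_or_removable_def by blast
  have "open (shadow U \<inter> - ({z, cnj z} - {z}))"
    using U(3) by (intro open_Int open_shadow open_Compl finite_imp_closed) (auto simp: slice_regular_on_def)
  moreover have "z \<in> shadow U \<inter> - ({z, cnj z} - {z})"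
    using U(1) by (auto simp: p_def shadow_def)
  ultimately have "\<forall>\<^sub>F w in at z. w \<in> (shadow U \<inter> - ({z, cnj z} - {z})) - {z}"
    by (rule eventually_at_in_open)
  then show ?thesis
  proof eventually_elim
    case (elim w)
    then have "slice_point quat_i w \<in> U - quat_sphere p"
      by (auto simp: p_def slice_point_in_sphere) (simp add: shadow_def)
    with U(2) show ?case by (auto simp: shadow_def)
  qed
qed

text \<open>
Near a singular sphere the stem is a holomorphic stem divided by a power of \<open>\<Delta>\<^sub>p\<close>.
\<close>
lemma stem_of_mero:
  assumes "f \<in> semi_regular \<Omega>"
  shows "stem_of f \<in> mero_stems \<Omega>"
proof -
  have sr: "slice_regular_on (dom f) (\<lambda>q. the (f q))"
    using assms by (simp add: semi_regular_def)
  have circ: "circular (dom f)" using sr by (simp add: slice_regular_on_def)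
  have "(\<lambda>z. c (stem_of f z)) meromorphic_on {z}" if c: "c \<in> bcoords" and z: "z \<in> shadow \<Omega>" for c z
  proof (cases "z \<in> shadow (dom f)")
    case True
    then show ?thesis
      using stem_analytic[OF sr _ c] by (intro analytic_on_imp_meromorphic_on)
  next
    case False
    define p where "p = slice_point quat_i z"
    from False z assms have "pole_or_removable f p"
      by (auto simp: p_def shadow_def semi_regular_def)
    then obtain U k m where U: "p \<in> U" "U - quat_sphere p \<subseteq> dom f" "slice_regular_on U k"
      "\<forall>q \<in> U - quat_sphere p. k q = Delta p q ^ m * the (f q)"
      unfolding pole_or_removable_def by blast
    have circU: "circular U" and opU: "open U" using U(3) by (simp_all add: slice_regular_on_def)
    have zU: "z \<in> shadow U" using U(1) by (simp add: p_def shadow_def)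
    have eq: "stem k w = bscalar (((w - z) * (w - cnj z)) ^ m) * stem_of f w"
      if w: "w \<in> shadow U" "w \<noteq> z" "w \<noteq> cnj z" for w
    proof -
      have "k (slice_point I w) = at_unit I (bscalar (((w - z) * (w - cnj z)) ^ m) * stem_of f w)"
        if I: "I \<in> \<S>" for I
      proof -
        have q: "slice_point I w \<in> U - quat_sphere p"
          using w I slice_point_in_circular[OF circU I] by (simp add: p_def slice_point_in_sphere)
        then have "w \<in> shadow (dom f)"
          using U(2) slice_point_in_circular[OF circ I] by blast
        then have "the (f (slice_point I w)) = at_unit I (stem_of f w)"
          using slice_regular_representation[OF sr _ I] by blast
        with q U(4) show ?thesis
          by (simp add: at_unit_scalar_mult[OF I] slice_point_power[OF I] p_def Delta_slice_point[OF I])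
      qed
      then show ?thesis by (rule stem_eqI)
    qed
    have "\<forall>\<^sub>F w in at z. w \<in> (shadow U \<inter> - ({z, cnj z} - {z})) - {z}"
      using zU opU
      by (intro eventually_at_in_open open_Int open_shadow open_Compl finite_imp_closed) auto
    then have ev: "\<forall>\<^sub>F w in at z. c (stem k w) / ((w - z) * (w - cnj z)) ^ m = c (stem_of f w)"
    proof eventually_elim
      case (elim w)
      then have "w \<noteq> z" "w \<noteq> cnj z" "w \<in> shadow U" by auto
      then show ?case
        using eq[of w] c by (auto simp: bcoords_def bscalar_def biquat_arith)
    qed
    have "(\<lambda>w. c (stem k w)) meromorphic_on {z}"
      using stem_analytic[OF U(3) zU c] by (rule analytic_on_imp_meromorphic_on)
    then have "(\<lambda>w. c (stem k w) / ((w - z) * (w - cnj z)) ^ m) meromorphic_on {z}"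
      by (intro meromorphic_intros)
    moreover have "(\<lambda>w. c (stem k w) / ((w - z) * (w - cnj z)) ^ m) meromorphic_on {z} \<longleftrightarrow>
        (\<lambda>w. c (stem_of f w)) meromorphic_on {z}"
      by (rule meromorphic_on_cong) (use ev in simp_all)
    ultimately show ?thesis by blast
  qed
  then show ?thesis
    by (auto simp: mero_stems_def stem_cnj meromorphic_on_meromorphic_at[of _ "shadow \<Omega>"])
qed

text \<open>
The converse of \<open>stem_of_mero\<close>.  Around a point \<open>p\<close> outside the domain, a common power of \<open>\<Delta>\<^sub>p\<close>
clears the poles of all four coordinates at both points \<open>z\<close> and \<open>z\<^sup>c\<close> of the shadow of the sphere.
After the removable singularities have been filled in, the function induced by the resulting
holomorphic stem is the required slice regular extension.
\<close>
lemma semi_regularI: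
  assumes "open (dom f)" "circular (dom f)" "circular \<Omega>" "dom f \<subseteq> \<Omega>"
    and h: "h \<in> mero_stems \<Omega>"
    and rep: "\<And>I z. I \<in> \<S> \<Longrightarrow> z \<in> shadow (dom f) \<Longrightarrow> the (f (slice_point I z)) = at_unit I (h z)"
    and ana: "\<And>c z. c \<in> bcoords \<Longrightarrow> z \<in> shadow (dom f) \<Longrightarrow> (\<lambda>z. c (h z)) analytic_on {z}"
    and dense: "\<And>z. z \<in> shadow \<Omega> \<Longrightarrow> \<forall>\<^sub>F w in at z. w \<in> shadow (dom f)"
  shows "f \<in> semi_regular \<Omega>"
proof -
  have "slice_regular_on (dom f) (\<lambda>q. the (f q))"
    using assms(1,2) rep mero_stems_symmetric[OF h] ana by (rule slice_regular_onI)
  moreover have "pole_or_removable f p" if p: "p \<in> \<Omega> - dom f" for p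
  proof -
    define z where "z = profile p"
    have z: "z \<in> shadow \<Omega>" "cnj z \<in> shadow \<Omega>"
      using p assms(3) by (simp_all add: z_def profile_in_shadow cnj_in_shadow)
    obtain r where r: "r > 0" and ball: "\<And>w. w \<in> ball z r \<Longrightarrow> w \<noteq> z \<Longrightarrow> w \<in> shadow (dom f)"
      using dense[OF z(1)] unfolding eventually_at by (auto simp: dist_commute)
    have "(\<lambda>w. c (h w)) meromorphic_on {z}" if "c \<in> bcoords" for c
      using mero_stems_meromorphic[OF h that] z(1) by (meson empty_subsetI insert_subset meromorphic_on_subset)
    then obtain m where m: "\<And>c. c \<in> bcoords \<Longrightarrow> \<exists>l. ((\<lambda>w. (w - z) ^ m * c (h w)) \<longlongrightarrow> l) (at z)"
      using clear_common_denominator[of bcoords h z] by (auto simp: bcoords_def)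
    define P where "P w = ((w - z) * (w - cnj z)) ^ m" for w
    define F where "F c w = P w * c (h w)" for c :: "biquat \<Rightarrow> complex" and w
    define K where "K w = Biquat (remove_sings (F b0) w) (remove_sings (F b1) w)
      (remove_sings (F b2) w) (remove_sings (F b3) w)" for w
    have Fsym: "F c (cnj w) = cnj (F c w)" if "c \<in> bcoords" for c w
      using that by (simp add: F_def P_def mero_stems_symmetric[OF h] bcoords_bbar mult_ac)
    have Kc: "c (K w) = remove_sings (F c) w" if "c \<in> bcoords" for c w
      using that by (auto simp: K_def bcoords_def)
    have Ksym: "K (cnj w) = bbar (K w)" for w
      unfolding K_def bbar_def biquat.sel
      by (intro arg_cong4[of _ _ _ _ _ _ _ _ Biquat] remove_sings_symmetric Fsym) (simp_all add: bcoords_def)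
    have Fana: "F c analytic_on {w}" if "c \<in> bcoords" "w \<in> shadow (dom f)" for c w
      unfolding F_def P_def by (intro analytic_intros ana that)
    have Fsing: "remove_sings (F c) analytic_on {w}" if c: "c \<in> bcoords" and w: "w = z \<or> w = cnj z" for c w
    proof -
      obtain l where l: "((\<lambda>w. (w - z) ^ m * c (h w)) \<longlongrightarrow> l) (at z)" using m[OF c] by blast
      have "((\<lambda>w. (w - cnj z) ^ m * ((w - z) ^ m * c (h w))) \<longlongrightarrow> (z - cnj z) ^ m * l) (at z)"
        by (intro tendsto_intros l)
      then have lim: "(F c \<longlongrightarrow> (z - cnj z) ^ m * l) (at z)"
        by (simp add: F_def[abs_def] P_def power_mult_distrib mult_ac)
      have "F c meromorphic_on shadow \<Omega>"
        unfolding F_def P_def by (intro meromorphic_intros mero_stems_meromorphic[OF h c])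
      with w z have "isolated_singularity_at (F c) w"
        by (auto simp: meromorphic_on_altdef)
      then show ?thesis
        using lim tendsto_symmetric[of "F c", OF Fsym[OF c] lim] w remove_sings_analytic_at by blast
    qed
    \<comment> \<open>A ball around \<open>z\<close> suffices: \<open>profile\<close> folds the lower half plane onto the upper one, so \<open>U\<close> casts its shadow around \<open>cnj z\<close> as well.\<close>
    define U where "U = profile -` ball z r"
    have Uo: "open U" unfolding U_def by (intro open_vimage continuous_on_profile open_ball)
    have Uc: "circular U" unfolding U_def by (rule circular_vimage_profile)
    have "slice_regular_on U (induce K)"
    proof (rule slice_regular_onI[where h = K, OF Uo Uc _ Ksym])
      show "induce K (slice_point I w) = at_unit I (K w)" if "I \<in> \<S>" for I w
        using Ksym that by (rule induce_slice_point)
    next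
      fix c w assume c: "c \<in> bcoords" and w: "w \<in> shadow U"
      define w' where "w' = Complex (Re w) \<bar>Im w\<bar>"
      have w': "w' \<in> ball z r" using w by (simp add: shadow_def U_def profile_slice_point w'_def)
      have ww: "w = w' \<or> w = cnj w'" by (auto simp: w'_def complex_eq_iff abs_if)
      show "(\<lambda>w. c (K w)) analytic_on {w}"
        unfolding Kc[OF c]
      proof (cases "w' = z")
        case True
        then show "remove_sings (F c) analytic_on {w}" using Fsing[OF c] ww by blast
      next
        case False
        then have "w' \<in> shadow (dom f)" using ball w' by blast
        then have "w \<in> shadow (dom f)" using ww cnj_in_shadow[OF assms(2)] by metis
        then show "remove_sings (F c) analytic_on {w}"
          by (intro remove_sings_analytic_on Fana c)
      qed
    qed
    moreover have "p \<in> U" using r by (simp add: U_def z_def)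
    moreover have "q \<in> dom f \<and> induce K q = Delta p q ^ m * the (f q)" if q: "q \<in> U - quat_sphere p" for q
    proof -
      obtain I where I: "I \<in> \<S>" "q = slice_point I (profile q)" by (rule slice_point_profile)
      obtain J where J: "J \<in> \<S>" "p = slice_point J z" unfolding z_def by (rule slice_point_profile)
      define w where "w = profile q"
      have w: "w \<in> ball z r" "w \<noteq> z"
        using q by (auto simp: U_def w_def z_def profile_eq_iff_sphere)
      then have wd: "w \<in> shadow (dom f)" by (rule ball)
      have "c (K w) = P w * c (h w)" if "c \<in> bcoords" for c
        using Kc[OF that] Fana[OF that wd] by (simp add: F_def)
      then have "K w = bscalar (P w) * h w"
        by (simp add: biquat_eq_iff bcoords_def bscalar_def biquat_arith)
      then have "induce K q = slice_point I (P w) * at_unit I (h w)"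
        using induce_slice_point[of K, OF Ksym I(1), of w] I
        by (simp add: w_def at_unit_scalar_mult)
      moreover have "slice_point I (P w) = Delta p q ^ m"
        using I J by (simp add: P_def slice_point_power Delta_slice_point w_def)
          (metis Delta_slice_point)
      moreover have "slice_point I w \<in> dom f"
        using wd slice_point_in_circular[OF assms(2) I(1)] by blast
      ultimately show ?thesis
        using rep[OF I(1) wd] I(2) by (simp add: w_def)
    qed
    ultimately show ?thesis
      unfolding pole_or_removable_def by blast
  qed
  ultimately show ?thesis
    using assms(4) by (simp add: semi_regular_def)
qed

text \<open>
The domain consists of the spheres over the points at which all four coordinates are analytic.
\<close>
lemma ex_semi_regular_representing:
  assumes "open \<Omega>" "circular \<Omega>" and h: "h \<in> mero_stems \<Omega>"
  shows "\<exists>f \<in> semi_regular \<Omega>.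
    \<forall>I\<in>\<S>. \<forall>z\<in>shadow (dom f). the (f (slice_point I z)) = at_unit I (h z)"
proof -
  define G where "G = {z \<in> shadow \<Omega>. \<forall>c\<in>bcoords. (\<lambda>z. c (h z)) analytic_on {z}}"
  define f where "f q = (if profile q \<in> G then Some (induce h q) else None)" for q
  have dom: "dom f = profile -` G" by (auto simp: f_def split: if_splits)
  have "open {z. (\<lambda>z. c (h z)) analytic_on {z}}" for c
    unfolding open_subopen[of "Collect _"] by (auto simp: analytic_at)
  then have "open (shadow \<Omega> \<inter> (\<Inter>c\<in>bcoords. {z. (\<lambda>z. c (h z)) analytic_on {z}}))"
    by (intro open_Int open_shadow assms open_INT) (auto simp: bcoords_def)
  also have "\<dots> = G" by (auto simp: G_def)
  finally have oG: "open G" .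
  have cG: "cnj z \<in> G" if "z \<in> G" for z
    using that analytic_symmetric[of "\<lambda>z. c (h z)" z for c] assms(2)
    by (auto simp: G_def cnj_in_shadow mero_stems_symmetric[OF h] bcoords_bbar)
  have od: "open (dom f)" unfolding dom by (intro open_vimage continuous_on_profile oG)
  have cd: "circular (dom f)" unfolding dom by (rule circular_vimage_profile)
  \<comment> \<open>The definition of \<open>f\<close> only looks at the upper half plane, so this needs the symmetry of \<open>G\<close>.\<close>
  have sd: "shadow (dom f) = G"
  proof -
    have "z \<in> G \<longleftrightarrow> Complex (Re z) \<bar>Im z\<bar> \<in> G" for z
      using cG[of z] cG[of "cnj z"] by (cases "Im z \<ge> 0") (auto simp: complex_eq_iff complex_cnj cnj.code)
    then show ?thesis by (auto simp: shadow_def dom profile_slice_point)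
  qed
  have rep: "the (f (slice_point I z)) = at_unit I (h z)" if "I \<in> \<S>" "z \<in> shadow (dom f)" for I z
    using that slice_point_in_circular[OF cd, of I z] induce_slice_point[of h, OF mero_stems_symmetric[OF h]]
    by (auto simp: dom f_def)
  have dense: "\<forall>\<^sub>F w in at z. w \<in> shadow (dom f)" if z: "z \<in> shadow \<Omega>" for z
  proof -
    have "\<forall>\<^sub>F w in at z. (\<lambda>z. c (h z)) analytic_on {w}" if "c \<in> bcoords" for c
      using meromorphic_on_imp_analytic_cosparse[OF mero_stems_meromorphic[OF h that]] z
      by (rule eventually_cosparse_imp_eventually_at)
    then have "\<forall>\<^sub>F w in at z. \<forall>c\<in>bcoords. (\<lambda>z. c (h z)) analytic_on {w}"
      by (intro eventually_ball_finite) (auto simp: bcoords_def)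
    moreover have "\<forall>\<^sub>F w in at z. w \<in> shadow \<Omega>"
      by (intro eventually_at_in_open' open_shadow assms z)
    ultimately show ?thesis
      unfolding sd by eventually_elim (simp add: G_def)
  qed
  have "dom f \<subseteq> \<Omega>" using assms(2) by (auto simp: dom G_def profile_in_shadow)
  moreover have "(\<lambda>z. c (h z)) analytic_on {z}" if "c \<in> bcoords" "z \<in> shadow (dom f)" for c z
    using that by (auto simp: sd G_def)
  ultimately have "f \<in> semi_regular \<Omega>"
    using rep dense by (intro semi_regularI[OF od cd assms(2) _ h])
  with rep show ?thesis by blast
qed

lemma mero_stems_mult:
  "h \<in> mero_stems \<Omega> \<Longrightarrow> k \<in> mero_stems \<Omega> \<Longrightarrow> (\<lambda>z. h z * k z) \<in> mero_stems \<Omega>"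
  by (simp add: mero_stems_def bbar_mult) (auto simp: bcoords_def times_biquat_def intro!: meromorphic_intros)

lemma mero_stems_add:
  "h \<in> mero_stems \<Omega> \<Longrightarrow> k \<in> mero_stems \<Omega> \<Longrightarrow> (\<lambda>z. h z + k z) \<in> mero_stems \<Omega>"
  by (simp add: mero_stems_def bbar_add) (auto simp: bcoords_def plus_biquat_def intro!: meromorphic_intros)

lemma mero_stems_uminus: "h \<in> mero_stems \<Omega> \<Longrightarrow> (\<lambda>z. - h z) \<in> mero_stems \<Omega>"
  by (simp add: mero_stems_def bbar_uminus) (auto simp: bcoords_def uminus_biquat_def intro!: meromorphic_intros)

lemma mero_stems_bcnj: "h \<in> mero_stems \<Omega> \<Longrightarrow> (\<lambda>z. bcnj (h z)) \<in> mero_stems \<Omega>"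
  by (simp add: mero_stems_def bbar_bcnj) (auto simp: bcoords_def bcnj_def intro!: meromorphic_intros)

lemma mero_stems_bquat: "(\<lambda>z. bquat q) \<in> mero_stems \<Omega>"
  by (auto simp: mero_stems_def bbar_bquat)

lemma mero_stems_bscalar_iff:
  "(\<lambda>z. bscalar (k z)) \<in> mero_stems \<Omega> \<longleftrightarrow>
    (\<forall>z. k (cnj z) = cnj (k z)) \<and> k meromorphic_on shadow \<Omega>"
proof -
  have "(\<forall>c\<in>bcoords. (\<lambda>z. c (bscalar (k z))) meromorphic_on shadow \<Omega>) \<longleftrightarrow> k meromorphic_on shadow \<Omega>"
    by (simp add: bcoords_def bscalar_def meromorphic_on_const)
  then show ?thesis
    by (simp add: mero_stems_def bbar_bscalar)
qed

lemma mero_stems_coord: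
  "h \<in> mero_stems \<Omega> \<Longrightarrow> c \<in> bcoords \<Longrightarrow> (\<lambda>z. bscalar (c (h z))) \<in> mero_stems \<Omega>"
  unfolding mero_stems_bscalar_iff
  by (simp add: mero_stems_symmetric mero_stems_meromorphic bcoords_bbar)

lemma analytic_coord_mult_add:
  assumes h: "\<And>c. c \<in> bcoords \<Longrightarrow> (\<lambda>z. c (h z)) analytic_on A"
    and k: "\<And>c. c \<in> bcoords \<Longrightarrow> (\<lambda>z. c (k z)) analytic_on A"
    and c: "c \<in> bcoords"
  shows "(\<lambda>z. c (h z * k z)) analytic_on A" "(\<lambda>z. c (h z + k z)) analytic_on A"
proof -
  have "(\<lambda>z. b0 (h z)) analytic_on A" "(\<lambda>z. b1 (h z)) analytic_on A"
       "(\<lambda>z. b2 (h z)) analytic_on A" "(\<lambda>z. b3 (h z)) analytic_on A"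
       "(\<lambda>z. b0 (k z)) analytic_on A" "(\<lambda>z. b1 (k z)) analytic_on A"
       "(\<lambda>z. b2 (k z)) analytic_on A" "(\<lambda>z. b3 (k z)) analytic_on A"
    by (intro h k; simp add: bcoords_def)+
  then show "(\<lambda>z. c (h z * k z)) analytic_on A" "(\<lambda>z. c (h z + k z)) analytic_on A"
    using c by (auto simp: bcoords_def times_biquat_def plus_biquat_def intro!: analytic_intros)
qed

section \<open>The algebra of semi-regular functions\<close>

text \<open>
The equality holds outside a set that is sparse in the shadow; this is the identification of
functions agreeing where both are defined.
\<close>
definition sem_of_stem :: "quat set \<Rightarrow> (complex \<Rightarrow> biquat) \<Rightarrow> sem"
  where "sem_of_stem \<Omega> h = {f \<in> semi_regular \<Omega>. \<forall>\<^sub>\<approx>z\<in>shadow \<Omega>. stem_of f z = h z}"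

locale open_circular_set =
  fixes \<Omega> :: "quat set"
  assumes open_circular: "open \<Omega>" "circular \<Omega>"

begin

lemma cosparse_iff: "eventually P (cosparse (shadow \<Omega>)) \<longleftrightarrow> (\<forall>z\<in>shadow \<Omega>. eventually P (at z))"
  by (rule eventually_cosparse_open_eq) (rule open_shadow[OF open_circular(1)])

lemma almost_all_in_dom: "f \<in> semi_regular \<Omega> \<Longrightarrow> \<forall>\<^sub>\<approx>z\<in>shadow \<Omega>. z \<in> shadow (dom f)"
  unfolding cosparse_iff using eventually_in_shadow_dom by blast

text \<open>
The common part of the proofs that sums and star products of semi-regular functions are
semi-regular.
\<close>
lemma semi_regular_binopI:
  assumes f: "f \<in> semi_regular \<Omega>" and g: "g \<in> semi_regular \<Omega>"
    and dom: "dom s = dom f \<inter> dom g"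
    and rep: "\<And>I z. I \<in> \<S> \<Longrightarrow> z \<in> shadow (dom f) \<Longrightarrow> z \<in> shadow (dom g) \<Longrightarrow>
      the (s (slice_point I z)) = at_unit I (op (stem_of f z) (stem_of g z))"
    and h: "(\<lambda>z. op (stem_of f z) (stem_of g z)) \<in> mero_stems \<Omega>"
    and ana: "\<And>c z. c \<in> bcoords \<Longrightarrow> z \<in> shadow (dom f) \<Longrightarrow> z \<in> shadow (dom g) \<Longrightarrow>
      (\<lambda>z. c (op (stem_of f z) (stem_of g z))) analytic_on {z}"
  shows "s \<in> semi_regular \<Omega>" "\<forall>\<^sub>\<approx>z\<in>shadow \<Omega>. stem_of s z = op (stem_of f z) (stem_of g z)"
proof -
  have sh: "shadow (dom s) = shadow (dom f) \<inter> shadow (dom g)"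
    by (simp add: dom shadow_Int)
  have oc: "open (dom s)" "circular (dom s)"
    using semi_regular_dom[OF f] semi_regular_dom[OF g] by (auto simp: dom circular_Int)
  have dense: "\<forall>\<^sub>\<approx>z\<in>shadow \<Omega>. z \<in> shadow (dom s)"
    using almost_all_in_dom[OF f] almost_all_in_dom[OF g] by eventually_elim (simp add: sh)
  show "s \<in> semi_regular \<Omega>"
    using semi_regular_dom[OF f] rep ana dense unfolding cosparse_iff
    by (intro semi_regularI[OF oc open_circular(2) _ h]) (auto simp: dom shadow_Int)
  show "\<forall>\<^sub>\<approx>z\<in>shadow \<Omega>. stem_of s z = op (stem_of f z) (stem_of g z)"
    using dense by eventually_elim (rule stem_eqI, auto intro: rep simp: sh)
qed

lemma semi_star_semi_regular:
  assumes f: "f \<in> semi_regular \<Omega>" and g: "g \<in> semi_regular \<Omega>"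
  shows "semi_star f g \<in> semi_regular \<Omega>"
    "\<forall>\<^sub>\<approx>z\<in>shadow \<Omega>. stem_of (semi_star f g) z = stem_of f z * stem_of g z"
proof -
  have 1: "dom (semi_star f g) = dom f \<inter> dom g"
    by (auto simp: semi_star_def dom_def)
  have 2: "the (semi_star f g (slice_point I z)) = at_unit I (stem_of f z * stem_of g z)"
    if "I \<in> \<S>" "z \<in> shadow (dom f)" "z \<in> shadow (dom g)" for I z
  proof -
    have "slice_point I z \<in> dom f \<inter> dom g"
      using that semi_regular_dom(2)[OF f] semi_regular_dom(2)[OF g] slice_point_in_circular by blast
    then have "the (semi_star f g (slice_point I z)) =
        star_fun (\<lambda>q. the (f q)) (\<lambda>q. the (g q)) (slice_point I z)"
      by (simp add: semi_star_def)
    also have "\<dots> = at_unit I (stem_of f z * stem_of g z)"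
      using that semi_regular_rep[OF f] semi_regular_rep[OF g] by (intro star_fun_at_unit) auto
    finally show ?thesis .
  qed
  have 3: "(\<lambda>z. stem_of f z * stem_of g z) \<in> mero_stems \<Omega>"
    by (intro mero_stems_mult stem_of_mero f g)
  have 4: "(\<lambda>z. c (stem_of f z * stem_of g z)) analytic_on {z}"
    if "c \<in> bcoords" "z \<in> shadow (dom f)" "z \<in> shadow (dom g)" for c z
    by (intro analytic_coord_mult_add semi_regular_analytic[OF f] semi_regular_analytic[OF g] that)
  show "semi_star f g \<in> semi_regular \<Omega>"
    "\<forall>\<^sub>\<approx>z\<in>shadow \<Omega>. stem_of (semi_star f g) z = stem_of f z * stem_of g z"
    using semi_regular_binopI[where op = "(*)", OF f g 1 2 3 4] by blast+
qed

lemma semi_add_semi_regular: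
  assumes f: "f \<in> semi_regular \<Omega>" and g: "g \<in> semi_regular \<Omega>"
  shows "semi_add f g \<in> semi_regular \<Omega>"
    "\<forall>\<^sub>\<approx>z\<in>shadow \<Omega>. stem_of (semi_add f g) z = stem_of f z + stem_of g z"
proof -
  have 1: "dom (semi_add f g) = dom f \<inter> dom g"
    by (auto simp: semi_add_def dom_def)
  have 2: "the (semi_add f g (slice_point I z)) = at_unit I (stem_of f z + stem_of g z)"
    if "I \<in> \<S>" "z \<in> shadow (dom f)" "z \<in> shadow (dom g)" for I z
  proof -
    have "slice_point I z \<in> dom f \<inter> dom g"
      using that semi_regular_dom(2)[OF f] semi_regular_dom(2)[OF g] slice_point_in_circular by blast
    then show ?thesis
      using that by (simp add: semi_add_def at_unit_add semi_regular_rep[OF f] semi_regular_rep[OF g])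
  qed
  have 3: "(\<lambda>z. stem_of f z + stem_of g z) \<in> mero_stems \<Omega>"
    by (intro mero_stems_add stem_of_mero f g)
  have 4: "(\<lambda>z. c (stem_of f z + stem_of g z)) analytic_on {z}"
    if "c \<in> bcoords" "z \<in> shadow (dom f)" "z \<in> shadow (dom g)" for c z
    by (intro analytic_coord_mult_add semi_regular_analytic[OF f] semi_regular_analytic[OF g] that)
  show "semi_add f g \<in> semi_regular \<Omega>"
    "\<forall>\<^sub>\<approx>z\<in>shadow \<Omega>. stem_of (semi_add f g) z = stem_of f z + stem_of g z"
    using semi_regular_binopI[where op = "(+)", OF f g 1 2 3 4] by blast+
qed

lemma semi_const_semi_regular:
  shows "semi_const \<Omega> q \<in> semi_regular \<Omega>"
    and "\<forall>\<^sub>\<approx>z\<in>shadow \<Omega>. stem_of (semi_const \<Omega> q) z = bquat q"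
proof -
  have dom: "dom (semi_const \<Omega> q) = \<Omega>"
    by (auto simp: semi_const_def dom_def)
  have rep: "the (semi_const \<Omega> q (slice_point I z)) = at_unit I (bquat q)"
    if "I \<in> \<S>" "z \<in> shadow (dom (semi_const \<Omega> q))" for I z
    using that slice_point_in_circular[OF open_circular(2)]
    by (simp add: dom) (simp add: semi_const_def at_unit_bquat)
  have dense: "\<forall>\<^sub>\<approx>z\<in>shadow \<Omega>. z \<in> shadow (dom (semi_const \<Omega> q))"
    unfolding dom using open_circular by (intro eventually_in_cosparse open_shadow) auto
  show "semi_const \<Omega> q \<in> semi_regular \<Omega>"
    using dense unfolding cosparse_iff
    by (intro semi_regularI[OF _ _ open_circular(2) _ mero_stems_bquat[of q]] rep)
       (auto simp: dom open_circular)
  show "\<forall>\<^sub>\<approx>z\<in>shadow \<Omega>. stem_of (semi_const \<Omega> q) z = bquat q"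
    using dense by eventually_elim (rule stem_eqI, rule rep)
qed

text \<open>
Agreement of the functions on the intersection of their domains gives agreement of stems almost
everywhere, since both domains have sparse complement.  The converse follows by continuity of the
stems.  In particular the relation is transitive, which is not evident from its definition.
\<close>
lemma sem_rel_iff:
  "(f, g) \<in> sem_rel \<Omega> \<longleftrightarrow> f \<in> semi_regular \<Omega> \<and> g \<in> semi_regular \<Omega> \<and>
    (\<forall>\<^sub>\<approx>z\<in>shadow \<Omega>. stem_of f z = stem_of g z)"
proof (cases "f \<in> semi_regular \<Omega> \<and> g \<in> semi_regular \<Omega>")
  case True
  then have f: "f \<in> semi_regular \<Omega>" and g: "g \<in> semi_regular \<Omega>" by auto
  have sp: "slice_point I z \<in> dom f \<inter> dom g \<longleftrightarrow> z \<in> shadow (dom f) \<inter> shadow (dom g)"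
    if "I \<in> \<S>" for I z
    using that slice_point_in_circular[OF semi_regular_dom(2)[OF f]]
      slice_point_in_circular[OF semi_regular_dom(2)[OF g]] by simp
  have "(\<forall>q\<in>dom f \<inter> dom g. f q = g q) \<longleftrightarrow> (\<forall>\<^sub>\<approx>z\<in>shadow \<Omega>. stem_of f z = stem_of g z)"
  proof
    assume eq: "\<forall>q\<in>dom f \<inter> dom g. f q = g q"
    show "\<forall>\<^sub>\<approx>z\<in>shadow \<Omega>. stem_of f z = stem_of g z"
      using almost_all_in_dom[OF f] almost_all_in_dom[OF g]
    proof eventually_elim
      case (elim z)
      then have "the (f (slice_point I z)) = at_unit I (stem_of g z)" if "I \<in> \<S>" for I
        using eq sp[OF that, of z] semi_regular_rep[OF g _ that] by auto
      then show ?case by (rule stem_eqI)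
    qed
  next
    assume eq: "\<forall>\<^sub>\<approx>z\<in>shadow \<Omega>. stem_of f z = stem_of g z"
    show "\<forall>q\<in>dom f \<inter> dom g. f q = g q"
    proof
      fix q assume q: "q \<in> dom f \<inter> dom g"
      obtain I where I: "I \<in> \<S>" "q = slice_point I (profile q)" by (rule slice_point_profile)
      define z where "z = profile q"
      have z: "z \<in> shadow (dom f)" "z \<in> shadow (dom g)"
        using sp[OF I(1), of z] q I(2) by (auto simp: z_def)
      then have "z \<in> shadow \<Omega>" using semi_regular_dom(3)[OF f] shadow_mono by blast
      with eq have ev: "\<forall>\<^sub>F w in at z. stem_of f w = stem_of g w"
        by (simp add: cosparse_iff)
      have "c (stem_of f z) = c (stem_of g z)" if c: "c \<in> bcoords" for c
      proof (rule tendsto_unique[OF at_neq_bot])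
        show "((\<lambda>w. c (stem_of f w)) \<longlongrightarrow> c (stem_of f z)) (at z)"
          using semi_regular_analytic[OF f z(1) c] analytic_at_imp_isCont isContD by blast
        have "((\<lambda>w. c (stem_of g w)) \<longlongrightarrow> c (stem_of g z)) (at z)"
          using semi_regular_analytic[OF g z(2) c] analytic_at_imp_isCont isContD by blast
        then show "((\<lambda>w. c (stem_of f w)) \<longlongrightarrow> c (stem_of g z)) (at z)"
          by (rule Lim_transform_eventually) (use ev in eventually_elim, simp)
      qed
      then have "stem_of f z = stem_of g z" by (simp add: biquat_eq_iff bcoords_def)
      then have "the (f q) = the (g q)"
        using semi_regular_rep[OF f z(1) I(1)] semi_regular_rep[OF g z(2) I(1)] I(2)
        by (simp add: z_def)
      then show "f q = g q" using q by (auto simp: dom_def)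
    qed
  qed
  with f g show ?thesis by (simp add: sem_rel_def)
qed (auto simp: sem_rel_def)

lemma sem_class_eq:
  assumes "f \<in> semi_regular \<Omega>" "\<forall>\<^sub>\<approx>z\<in>shadow \<Omega>. stem_of f z = h z"
  shows "sem_class \<Omega> f = sem_of_stem \<Omega> h"
proof -
  have *: "(\<forall>\<^sub>\<approx>z\<in>shadow \<Omega>. stem_of f z = stem_of g z) \<longleftrightarrow> (\<forall>\<^sub>\<approx>z\<in>shadow \<Omega>. stem_of g z = h z)" for g
    by (rule eventually_cong[OF assms(2)]) auto
  show ?thesis
    unfolding sem_class_def Image_singleton sem_rel_iff sem_of_stem_def
    by (simp only: * assms(1) simp_thms)
qed

lemma sem_of_stem_nonempty:
  assumes "h \<in> mero_stems \<Omega>"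
  shows "\<exists>f. f \<in> sem_of_stem \<Omega> h"
proof -
  obtain f where f: "f \<in> semi_regular \<Omega>"
    "\<forall>I\<in>\<S>. \<forall>z\<in>shadow (dom f). the (f (slice_point I z)) = at_unit I (h z)"
    using ex_semi_regular_representing[OF open_circular assms] by blast
  have "\<forall>\<^sub>\<approx>z\<in>shadow \<Omega>. stem_of f z = h z"
    using almost_all_in_dom[OF f(1)] by eventually_elim (rule stem_eqI, use f(2) in blast)
  with f show ?thesis by (auto simp: sem_of_stem_def)
qed

lemma sem_of_stem_eq_iff:
  assumes "h \<in> mero_stems \<Omega>"
  shows "sem_of_stem \<Omega> h = sem_of_stem \<Omega> k \<longleftrightarrow> (\<forall>\<^sub>\<approx>z\<in>shadow \<Omega>. h z = k z)"
proof
  assume eq: "sem_of_stem \<Omega> h = sem_of_stem \<Omega> k"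
  obtain f where "f \<in> sem_of_stem \<Omega> h" using sem_of_stem_nonempty[OF assms] by blast
  with eq have "\<forall>\<^sub>\<approx>z\<in>shadow \<Omega>. stem_of f z = h z" "\<forall>\<^sub>\<approx>z\<in>shadow \<Omega>. stem_of f z = k z"
    by (auto simp: sem_of_stem_def)
  then show "\<forall>\<^sub>\<approx>z\<in>shadow \<Omega>. h z = k z" by eventually_elim simp
next
  assume "\<forall>\<^sub>\<approx>z\<in>shadow \<Omega>. h z = k z"
  then have "(\<forall>\<^sub>\<approx>z\<in>shadow \<Omega>. stem_of f z = h z) \<longleftrightarrow> (\<forall>\<^sub>\<approx>z\<in>shadow \<Omega>. stem_of f z = k z)" for f
    by (rule eventually_cong) auto
  then show "sem_of_stem \<Omega> h = sem_of_stem \<Omega> k" by (simp add: sem_of_stem_def)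
qed

lemma sem_of_stem_eqI:
  assumes "\<forall>\<^sub>\<approx>z\<in>shadow \<Omega>. h z = k z" "h \<in> mero_stems \<Omega>"
  shows "sem_of_stem \<Omega> h = sem_of_stem \<Omega> k"
  using assms sem_of_stem_eq_iff by blast

lemma carrier_SEM: "carrier (SEM \<Omega>) = sem_of_stem \<Omega> ` mero_stems \<Omega>"
proof -
  have "sem_class \<Omega> f = sem_of_stem \<Omega> (stem_of f)" if "f \<in> semi_regular \<Omega>" for f
    using that by (rule sem_class_eq) simp
  moreover have "\<exists>f\<in>semi_regular \<Omega>. sem_of_stem \<Omega> h = sem_class \<Omega> f" if h: "h \<in> mero_stems \<Omega>" for h
    using sem_of_stem_nonempty[OF h] sem_class_eq by (auto simp: sem_of_stem_def)
  ultimately show ?thesis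
    using stem_of_mero by (auto simp: SEM_def quotient_def simp flip: sem_class_def)
qed

lemma carrier_SEM_E:
  assumes "A \<in> carrier (SEM \<Omega>)"
  obtains h where "h \<in> mero_stems \<Omega>" "A = sem_of_stem \<Omega> h"
  using assms by (auto simp: carrier_SEM)

lemma sem_of_stem_carrier: "h \<in> mero_stems \<Omega> \<Longrightarrow> sem_of_stem \<Omega> h \<in> carrier (SEM \<Omega>)"
  by (simp add: carrier_SEM)

lemma sem_of_stem_mult:
  assumes h: "h \<in> mero_stems \<Omega>" and k: "k \<in> mero_stems \<Omega>"
  shows "sem_of_stem \<Omega> h \<otimes>\<^bsub>SEM \<Omega>\<^esub> sem_of_stem \<Omega> k = sem_of_stem \<Omega> (\<lambda>z. h z * k z)"
proof -
  have "sem_class \<Omega> (semi_star f g) = sem_of_stem \<Omega> (\<lambda>z. h z * k z)"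
    if f: "f \<in> sem_of_stem \<Omega> h" and g: "g \<in> sem_of_stem \<Omega> k" for f g
  proof (rule sem_class_eq)
    have fs: "f \<in> semi_regular \<Omega>" and gs: "g \<in> semi_regular \<Omega>"
      using f g by (auto simp: sem_of_stem_def)
    show "semi_star f g \<in> semi_regular \<Omega>" by (rule semi_star_semi_regular[OF fs gs])
    have "\<forall>\<^sub>\<approx>z\<in>shadow \<Omega>. stem_of f z = h z" "\<forall>\<^sub>\<approx>z\<in>shadow \<Omega>. stem_of g z = k z"
      using f g by (auto simp: sem_of_stem_def)
    with semi_star_semi_regular(2)[OF fs gs]
    show "\<forall>\<^sub>\<approx>z\<in>shadow \<Omega>. stem_of (semi_star f g) z = h z * k z"
      by eventually_elim simp
  qed
  then have "(\<Union>f\<in>sem_of_stem \<Omega> h. \<Union>g\<in>sem_of_stem \<Omega> k. sem_class \<Omega> (semi_star f g))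
      = (\<Union>f\<in>sem_of_stem \<Omega> h. \<Union>g\<in>sem_of_stem \<Omega> k. sem_of_stem \<Omega> (\<lambda>z. h z * k z))"
    by (intro SUP_cong refl)
  moreover have "sem_of_stem \<Omega> h \<noteq> {}" "sem_of_stem \<Omega> k \<noteq> {}"
    using sem_of_stem_nonempty[OF h] sem_of_stem_nonempty[OF k] by blast+
  ultimately show ?thesis
    by (simp add: SEM_def)
qed

lemma sem_of_stem_add:
  assumes h: "h \<in> mero_stems \<Omega>" and k: "k \<in> mero_stems \<Omega>"
  shows "sem_of_stem \<Omega> h \<oplus>\<^bsub>SEM \<Omega>\<^esub> sem_of_stem \<Omega> k = sem_of_stem \<Omega> (\<lambda>z. h z + k z)"
proof -
  have "sem_class \<Omega> (semi_add f g) = sem_of_stem \<Omega> (\<lambda>z. h z + k z)"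
    if f: "f \<in> sem_of_stem \<Omega> h" and g: "g \<in> sem_of_stem \<Omega> k" for f g
  proof (rule sem_class_eq)
    have fs: "f \<in> semi_regular \<Omega>" and gs: "g \<in> semi_regular \<Omega>"
      using f g by (auto simp: sem_of_stem_def)
    show "semi_add f g \<in> semi_regular \<Omega>" by (rule semi_add_semi_regular[OF fs gs])
    have "\<forall>\<^sub>\<approx>z\<in>shadow \<Omega>. stem_of f z = h z" "\<forall>\<^sub>\<approx>z\<in>shadow \<Omega>. stem_of g z = k z"
      using f g by (auto simp: sem_of_stem_def)
    with semi_add_semi_regular(2)[OF fs gs]
    show "\<forall>\<^sub>\<approx>z\<in>shadow \<Omega>. stem_of (semi_add f g) z = h z + k z"
      by eventually_elim simp
  qed
  then have "(\<Union>f\<in>sem_of_stem \<Omega> h. \<Union>g\<in>sem_of_stem \<Omega> k. sem_class \<Omega> (semi_add f g))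
      = (\<Union>f\<in>sem_of_stem \<Omega> h. \<Union>g\<in>sem_of_stem \<Omega> k. sem_of_stem \<Omega> (\<lambda>z. h z + k z))"
    by (intro SUP_cong refl)
  moreover have "sem_of_stem \<Omega> h \<noteq> {}" "sem_of_stem \<Omega> k \<noteq> {}"
    using sem_of_stem_nonempty[OF h] sem_of_stem_nonempty[OF k] by blast+
  ultimately show ?thesis
    by (simp add: SEM_def)
qed

lemma sem_const_eq: "sem_const \<Omega> q = sem_of_stem \<Omega> (\<lambda>z. bquat q)"
  unfolding sem_const_def by (intro sem_class_eq semi_const_semi_regular)

lemma sem_zero_eq: "\<zero>\<^bsub>SEM \<Omega>\<^esub> = sem_of_stem \<Omega> (\<lambda>z. 0)"
  and sem_one_eq: "\<one>\<^bsub>SEM \<Omega>\<^esub> = sem_of_stem \<Omega> (\<lambda>z. 1)"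
  by (simp_all add: SEM_def sem_const_eq bquat_0 bquat_1)

lemma sem_of_stem_eq_0_iff:
  "h \<in> mero_stems \<Omega> \<Longrightarrow> sem_of_stem \<Omega> h = \<zero>\<^bsub>SEM \<Omega>\<^esub> \<longleftrightarrow> (\<forall>\<^sub>\<approx>z\<in>shadow \<Omega>. h z = 0)"
  by (simp add: sem_zero_eq sem_of_stem_eq_iff)

lemma sem_of_stem_uminus:
  assumes h: "h \<in> mero_stems \<Omega>"
  shows "\<ominus>\<^bsub>SEM \<Omega>\<^esub> sem_of_stem \<Omega> h = sem_of_stem \<Omega> (\<lambda>z. - h z)"
  unfolding a_inv_def m_inv_def
proof (rule the_equality)
  show "sem_of_stem \<Omega> (\<lambda>z. - h z) \<in> carrier (add_monoid (SEM \<Omega>)) \<and>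
    sem_of_stem \<Omega> h \<otimes>\<^bsub>add_monoid (SEM \<Omega>)\<^esub> sem_of_stem \<Omega> (\<lambda>z. - h z) = \<one>\<^bsub>add_monoid (SEM \<Omega>)\<^esub> \<and>
    sem_of_stem \<Omega> (\<lambda>z. - h z) \<otimes>\<^bsub>add_monoid (SEM \<Omega>)\<^esub> sem_of_stem \<Omega> h = \<one>\<^bsub>add_monoid (SEM \<Omega>)\<^esub>"
    by (simp add: sem_of_stem_add h mero_stems_uminus sem_zero_eq sem_of_stem_carrier)
next
  fix A assume A: "A \<in> carrier (add_monoid (SEM \<Omega>)) \<and>
    sem_of_stem \<Omega> h \<otimes>\<^bsub>add_monoid (SEM \<Omega>)\<^esub> A = \<one>\<^bsub>add_monoid (SEM \<Omega>)\<^esub> \<and>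
    A \<otimes>\<^bsub>add_monoid (SEM \<Omega>)\<^esub> sem_of_stem \<Omega> h = \<one>\<^bsub>add_monoid (SEM \<Omega>)\<^esub>"
  then obtain k where k: "k \<in> mero_stems \<Omega>" "A = sem_of_stem \<Omega> k"
    using carrier_SEM_E[of A] by auto
  have "\<forall>\<^sub>\<approx>z\<in>shadow \<Omega>. h z + k z = 0"
    using A k by (simp add: sem_of_stem_add h sem_of_stem_eq_0_iff mero_stems_add)
  then have "\<forall>\<^sub>\<approx>z\<in>shadow \<Omega>. k z = - h z"
    by eventually_elim (simp add: eq_neg_iff_add_eq_0 add.commute)
  then show "A = sem_of_stem \<Omega> (\<lambda>z. - h z)"
    unfolding k(2) by (intro sem_of_stem_eqI k)
qed

section \<open>Slice preserving elements, components and the norm\<close>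

text \<open>
The identity principle.  Near every point a meromorphic function vanishes identically or nowhere
(apart from the point itself), so \<open>\<Omega>\<close> is the disjoint union of two open sets, one for each
behaviour.  Working in \<open>\<Omega>\<close> rather than in its shadow avoids the case that the shadow is disconnected,
which happens if \<open>\<Omega>\<close> contains no real point.
\<close>
lemma mero_dichotomy:
  assumes "connected \<Omega>" and k: "(\<lambda>z. bscalar (k z)) \<in> mero_stems \<Omega>"
  shows "(\<forall>\<^sub>\<approx>z\<in>shadow \<Omega>. k z = 0) \<or> (\<forall>\<^sub>\<approx>z\<in>shadow \<Omega>. k z \<noteq> 0)"
proof -
  have sym: "k (cnj z) = cnj (k z)" and mero: "k meromorphic_on shadow \<Omega>" for z
    using k by (auto simp: mero_stems_bscalar_iff)
  \<comment> \<open>\<open>Z id\<close> collects the points near which \<open>k\<close> vanishes, \<open>Z Not\<close> those near which it does not.\<close>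
  define Z where "Z P = profile -` {z. \<forall>\<^sub>F w in at z. P (k w = 0)}" for P :: "bool \<Rightarrow> bool"
  have opZ: "open (Z P)" for P
  proof -
    show ?thesis
      unfolding Z_def by (intro open_vimage continuous_on_profile open_eventually_at)
  qed
  have cover: "q \<in> Z id \<or> q \<in> Z Not" if "q \<in> \<Omega>" for q
  proof -
    have "k meromorphic_on {profile q}"
      using mero that profile_in_shadow[OF open_circular(2)]
      by (meson empty_subsetI insert_subset meromorphic_on_subset)
    then have "(\<forall>\<^sub>F w in at (profile q). k w = 0) \<or> (\<forall>\<^sub>F w in at (profile q). k w \<noteq> 0)"
      using not_essential_frequently_0_imp_eventually_0[of k "profile q"]
      by (auto simp: meromorphic_at_iff frequently_def)
    then show ?thesis by (simp add: Z_def)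
  qed
  have disj: "Z id \<inter> Z Not = {}"
  proof -
    have False if "\<forall>\<^sub>F w in at z. k w = 0" "\<forall>\<^sub>F w in at z. k w \<noteq> 0" for z
    proof -
      from that have "\<forall>\<^sub>F w in at z. False" by eventually_elim simp
      then show False by simp
    qed
    then show ?thesis by (auto simp: Z_def)
  qed
  have all: "\<forall>\<^sub>\<approx>z\<in>shadow \<Omega>. P (k z = 0)" if "\<Omega> \<subseteq> Z P" for P
    unfolding cosparse_iff
  proof
    fix z assume z: "z \<in> shadow \<Omega>"
    define w where "w = Complex (Re z) \<bar>Im z\<bar>"
    have "slice_point quat_i z \<in> Z P" using that z by (auto simp: shadow_def)
    then have ev: "\<forall>\<^sub>F v in at w. P (k v = 0)"
      by (simp add: Z_def profile_slice_point w_def)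
    have "\<forall>\<^sub>F v in at (cnj w). P (k (cnj v) = 0)"
      by (rule eventually_compose_filterlim[OF ev]) (use filterlim_cnj_at[of "cnj w"] in simp)
    moreover have "z = w \<or> z = cnj w" by (auto simp: w_def complex_eq_iff abs_if)
    ultimately show "\<forall>\<^sub>F v in at z. P (k v = 0)"
      using ev by (auto simp: sym)
  qed
  have "Z id \<inter> \<Omega> = {} \<or> Z Not \<inter> \<Omega> = {}"
    using connectedD[OF assms(1) opZ[of id] opZ[of Not]] cover disj by blast
  then have "\<Omega> \<subseteq> Z id \<or> \<Omega> \<subseteq> Z Not" using cover by blast
  then show ?thesis using all[of id] all[of Not] by auto
qed

text \<open>
A slice preserving function has a scalar stem wherever it is defined, by \<open>slice_planes_imp_real\<close>.
\<close>
lemma carrier_SEM_R: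
  "carrier (SEM_R \<Omega>) = {sem_of_stem \<Omega> (\<lambda>z. bscalar (k z)) | k. (\<lambda>z. bscalar (k z)) \<in> mero_stems \<Omega>}"
proof (intro equalityI subsetI)
  fix A assume "A \<in> carrier (SEM_R \<Omega>)"
  then obtain f where f: "f \<in> semi_regular \<Omega>" "slice_preserving f" "A = sem_class \<Omega> f"
    by (auto simp: SEM_R_def)
  have "stem_of f z = bscalar (b0 (stem_of f z))" if z: "z \<in> shadow (dom f)" for z
  proof (rule slice_planes_imp_real)
    fix I assume I: "I \<in> \<S>"
    have "slice_point I z \<in> dom f \<inter> slice_plane I"
      using slice_point_in_circular[OF semi_regular_dom(2)[OF f(1)] I] z by (simp add: slice_plane_range)
    then show "at_unit I (stem_of f z) \<in> slice_plane I"
      using f(2) I semi_regular_rep[OF f(1) z I] unfolding slice_preserving_def by metis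
  qed
  then have "\<forall>\<^sub>\<approx>z\<in>shadow \<Omega>. stem_of f z = bscalar (b0 (stem_of f z))"
    using almost_all_in_dom[OF f(1)] by (auto elim: eventually_mono)
  then have "A = sem_of_stem \<Omega> (\<lambda>z. bscalar (b0 (stem_of f z)))"
    using sem_class_eq[OF f(1), of "\<lambda>z. bscalar (b0 (stem_of f z))"] f(3) by blast
  moreover have "(\<lambda>z. bscalar (b0 (stem_of f z))) \<in> mero_stems \<Omega>"
    by (intro mero_stems_coord stem_of_mero f) (simp add: bcoords_def)
  ultimately show "A \<in> {sem_of_stem \<Omega> (\<lambda>z. bscalar (k z)) | k. (\<lambda>z. bscalar (k z)) \<in> mero_stems \<Omega>}"
    by (intro CollectI exI[of _ "\<lambda>z. b0 (stem_of f z)"] conjI)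
next
  fix A assume "A \<in> {sem_of_stem \<Omega> (\<lambda>z. bscalar (k z)) | k. (\<lambda>z. bscalar (k z)) \<in> mero_stems \<Omega>}"
  then obtain k where k: "(\<lambda>z. bscalar (k z)) \<in> mero_stems \<Omega>"
    and A: "A = sem_of_stem \<Omega> (\<lambda>z. bscalar (k z))" by blast
  obtain f where f: "f \<in> semi_regular \<Omega>" "\<forall>I\<in>\<S>. \<forall>z\<in>shadow (dom f). the (f (slice_point I z)) = at_unit I (bscalar (k z))"
    using ex_semi_regular_representing[OF open_circular k] by blast
  have "\<forall>\<^sub>\<approx>z\<in>shadow \<Omega>. stem_of f z = bscalar (k z)"
    using almost_all_in_dom[OF f(1)] by eventually_elim (rule stem_eqI, use f(2) in blast)
  then have "A = sem_class \<Omega> f" using A sem_class_eq[OF f(1)] by metis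
  moreover have "slice_preserving f"
    unfolding slice_preserving_def
  proof (intro ballI)
    fix I q assume I: "I \<in> \<S>" and q: "q \<in> dom f \<inter> slice_plane I"
    then obtain z where z: "q = slice_point I z" unfolding slice_plane_range by blast
    then have "z \<in> shadow (dom f)"
      using q slice_point_in_circular[OF semi_regular_dom(2)[OF f(1)] I] by blast
    then have "the (f q) = slice_point I (k z)"
      using f(2) I by (simp add: z at_unit_bscalar)
    then show "the (f q) \<in> slice_plane I" by (simp add: slice_plane_range)
  qed
  ultimately show "A \<in> carrier (SEM_R \<Omega>)" using f(1) by (auto simp: SEM_R_def)
qed

lemma bscalar_stem_in_SEM_R:
  "(\<lambda>z. bscalar (k z)) \<in> mero_stems \<Omega> \<Longrightarrow>
    sem_of_stem \<Omega> (\<lambda>z. bscalar (k z)) \<in> carrier (SEM_R \<Omega>)"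
  unfolding carrier_SEM_R by (intro CollectI exI[of _ k] conjI refl)

definition imag_comb :: "(complex \<Rightarrow> complex) \<Rightarrow> (complex \<Rightarrow> complex) \<Rightarrow> (complex \<Rightarrow> complex) \<Rightarrow> complex \<Rightarrow> biquat"
  where "imag_comb k1 k2 k3 z = Biquat 0 (k1 z) (k2 z) (k3 z)"

lemma sem_vec_eq:
  assumes "(\<lambda>z. bscalar (k1 z)) \<in> mero_stems \<Omega>" "(\<lambda>z. bscalar (k2 z)) \<in> mero_stems \<Omega>"
    "(\<lambda>z. bscalar (k3 z)) \<in> mero_stems \<Omega>"
  shows "imag_comb k1 k2 k3 \<in> mero_stems \<Omega>"
    "sem_vec \<Omega> (sem_of_stem \<Omega> (\<lambda>z. bscalar (k1 z))) (sem_of_stem \<Omega> (\<lambda>z. bscalar (k2 z)))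
      (sem_of_stem \<Omega> (\<lambda>z. bscalar (k3 z))) = sem_of_stem \<Omega> (imag_comb k1 k2 k3)"
proof -
  have e: "(\<lambda>z. bscalar (k1 z) * bquat quat_i + bscalar (k2 z) * bquat quat_j + bscalar (k3 z) * bquat quat_k)
      = imag_comb k1 k2 k3"
    by (simp add: fun_eq_iff imag_comb_def bscalar_def bquat_def quat_i_def quat_j_def quat_k_def biquat_arith)
  show "imag_comb k1 k2 k3 \<in> mero_stems \<Omega>"
    unfolding e[symmetric] by (intro mero_stems_add mero_stems_mult mero_stems_bquat assms)
  show "sem_vec \<Omega> (sem_of_stem \<Omega> (\<lambda>z. bscalar (k1 z))) (sem_of_stem \<Omega> (\<lambda>z. bscalar (k2 z)))
      (sem_of_stem \<Omega> (\<lambda>z. bscalar (k3 z))) = sem_of_stem \<Omega> (imag_comb k1 k2 k3)"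
    unfolding e[symmetric]
    by (simp add: sem_vec_def sem_const_eq sem_of_stem_mult sem_of_stem_add
        mero_stems_add mero_stems_mult mero_stems_bquat assms)
qed

text \<open>
The components of a class are the four coordinates of its stem.  This yields both existence and
uniqueness of the decomposition, hence determines the definite descriptions \<open>sem_re\<close> and \<open>sem_cnj\<close>.
\<close>
lemma sem_components_iff:
  assumes h: "h \<in> mero_stems \<Omega>"
  shows "sem_components \<Omega> (sem_of_stem \<Omega> h) f0 f1 f2 f3 \<longleftrightarrow>
    f0 = sem_of_stem \<Omega> (\<lambda>z. bscalar (b0 (h z))) \<and> f1 = sem_of_stem \<Omega> (\<lambda>z. bscalar (b1 (h z))) \<and>
    f2 = sem_of_stem \<Omega> (\<lambda>z. bscalar (b2 (h z))) \<and> f3 = sem_of_stem \<Omega> (\<lambda>z. bscalar (b3 (h z)))"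
    (is "?L \<longleftrightarrow> ?R")
proof
  assume L: ?L
  then have "\<forall>f\<in>{f0, f1, f2, f3}. \<exists>k. (\<lambda>z. bscalar (k z)) \<in> mero_stems \<Omega> \<and>
      f = sem_of_stem \<Omega> (\<lambda>z. bscalar (k z))"
    unfolding sem_components_def carrier_SEM_R by blast
  then obtain k0 k1 k2 k3 where
    k: "(\<lambda>z. bscalar (k0 z)) \<in> mero_stems \<Omega>" "(\<lambda>z. bscalar (k1 z)) \<in> mero_stems \<Omega>"
       "(\<lambda>z. bscalar (k2 z)) \<in> mero_stems \<Omega>" "(\<lambda>z. bscalar (k3 z)) \<in> mero_stems \<Omega>"
    and f: "f0 = sem_of_stem \<Omega> (\<lambda>z. bscalar (k0 z))" "f1 = sem_of_stem \<Omega> (\<lambda>z. bscalar (k1 z))"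
       "f2 = sem_of_stem \<Omega> (\<lambda>z. bscalar (k2 z))" "f3 = sem_of_stem \<Omega> (\<lambda>z. bscalar (k3 z))"
    by auto
  have "sem_of_stem \<Omega> h = sem_of_stem \<Omega> (\<lambda>z. bscalar (k0 z) + imag_comb k1 k2 k3 z)"
    using L k by (simp add: sem_components_def f sem_vec_eq sem_of_stem_add)
  then have "\<forall>\<^sub>\<approx>z\<in>shadow \<Omega>. h z = bscalar (k0 z) + imag_comb k1 k2 k3 z"
    using sem_of_stem_eq_iff[OF h, of "\<lambda>z. bscalar (k0 z) + imag_comb k1 k2 k3 z"] by blast
  then have "\<forall>\<^sub>\<approx>z\<in>shadow \<Omega>. k0 z = b0 (h z) \<and> k1 z = b1 (h z) \<and> k2 z = b2 (h z) \<and> k3 z = b3 (h z)"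
    by eventually_elim (simp add: imag_comb_def bscalar_def biquat_arith)
  then show ?R
    unfolding f by (intro conjI sem_of_stem_eqI k) (auto elim!: eventually_mono)
next
  assume R: ?R
  have k: "(\<lambda>z. bscalar (b0 (h z))) \<in> mero_stems \<Omega>" "(\<lambda>z. bscalar (b1 (h z))) \<in> mero_stems \<Omega>"
       "(\<lambda>z. bscalar (b2 (h z))) \<in> mero_stems \<Omega>" "(\<lambda>z. bscalar (b3 (h z))) \<in> mero_stems \<Omega>"
    by (rule mero_stems_coord[OF h]; simp add: bcoords_def)+
  have "(\<lambda>z. bscalar (b0 (h z)) + imag_comb (\<lambda>z. b1 (h z)) (\<lambda>z. b2 (h z)) (\<lambda>z. b3 (h z)) z) = h"
    by (simp add: fun_eq_iff imag_comb_def bscalar_def biquat_arith)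
  then have "sem_of_stem \<Omega> h = f0 \<oplus>\<^bsub>SEM \<Omega>\<^esub> sem_vec \<Omega> f1 f2 f3"
    using R k by (simp add: sem_vec_eq sem_of_stem_add)
  then show ?L
    using R k[THEN bscalar_stem_in_SEM_R] by (simp add: sem_components_def)
qed

lemma sem_re_eq:
  assumes "h \<in> mero_stems \<Omega>"
  shows "sem_re \<Omega> (sem_of_stem \<Omega> h) = sem_of_stem \<Omega> (\<lambda>z. bscalar (b0 (h z)))"
  unfolding sem_re_def sem_components_iff[OF assms] by simp

lemma sem_cnj_eq:
  assumes h: "h \<in> mero_stems \<Omega>"
  shows "sem_cnj \<Omega> (sem_of_stem \<Omega> h) = sem_of_stem \<Omega> (\<lambda>z. bcnj (h z))"
proof -
  have k: "(\<lambda>z. bscalar (b0 (h z))) \<in> mero_stems \<Omega>" "(\<lambda>z. bscalar (b1 (h z))) \<in> mero_stems \<Omega>"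
       "(\<lambda>z. bscalar (b2 (h z))) \<in> mero_stems \<Omega>" "(\<lambda>z. bscalar (b3 (h z))) \<in> mero_stems \<Omega>"
    by (rule mero_stems_coord[OF h]; simp add: bcoords_def)+
  have "(\<lambda>z. bscalar (b0 (h z)) + - imag_comb (\<lambda>z. b1 (h z)) (\<lambda>z. b2 (h z)) (\<lambda>z. b3 (h z)) z) = (\<lambda>z. bcnj (h z))"
    by (simp add: fun_eq_iff imag_comb_def bscalar_def bcnj_def biquat_arith)
  then show ?thesis
    unfolding sem_cnj_def sem_components_iff[OF h] using k
    by (simp add: a_minus_def sem_vec_eq sem_of_stem_uminus sem_of_stem_add mero_stems_uminus)
qed

text \<open>
The symmetrization \<open>f\<^sup>s\<close> is the norm of the stem, because \<open>a\<close> times its quaternionic conjugate is the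
scalar \<open>bnorm a\<close>.
\<close>
lemma sem_zero_divisor_iff:
  assumes h: "h \<in> mero_stems \<Omega>"
  shows "sem_zero_divisor \<Omega> (sem_of_stem \<Omega> h) \<longleftrightarrow>
    \<not> (\<forall>\<^sub>\<approx>z\<in>shadow \<Omega>. h z = 0) \<and> (\<forall>\<^sub>\<approx>z\<in>shadow \<Omega>. bnorm (h z) = 0)"
proof -
  have "sem_symm \<Omega> (sem_of_stem \<Omega> h) = sem_of_stem \<Omega> (\<lambda>z. bscalar (bnorm (h z)))"
    by (simp add: sem_symm_def sem_cnj_eq h sem_of_stem_mult mero_stems_bcnj mult_bcnj)
  moreover have "(\<lambda>z. bscalar (bnorm (h z))) \<in> mero_stems \<Omega>"
    using mero_stems_mult[OF h mero_stems_bcnj[OF h]] by (simp add: mult_bcnj)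
  ultimately show ?thesis
    by (simp add: sem_zero_divisor_def sem_of_stem_carrier h sem_of_stem_eq_0_iff)
qed

lemma non_zero_divisor_bnorm:
  assumes "connected \<Omega>" and h: "h \<in> mero_stems \<Omega>"
    and "sem_of_stem \<Omega> h \<noteq> \<zero>\<^bsub>SEM \<Omega>\<^esub>" "\<not> sem_zero_divisor \<Omega> (sem_of_stem \<Omega> h)"
  shows "\<forall>\<^sub>\<approx>z\<in>shadow \<Omega>. bnorm (h z) \<noteq> 0"
proof -
  have k: "(\<lambda>z. bscalar (bnorm (h z))) \<in> mero_stems \<Omega>"
    using mero_stems_mult[OF h mero_stems_bcnj[OF h]] by (simp add: mult_bcnj)
  have "\<not> (\<forall>\<^sub>\<approx>z\<in>shadow \<Omega>. bnorm (h z) = 0)"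
    using assms(3,4) by (simp add: sem_zero_divisor_iff h sem_of_stem_eq_0_iff)
  with mero_dichotomy[OF assms(1) k] show ?thesis by blast
qed

section \<open>The idempotents of a zero divisor\<close>

text \<open>
The contrapositive form in which non-emptiness of the shadow is used below: a class that is not
zero provides the assumption.
\<close>
lemma cosparse_shadow_nontrivial:
  assumes "\<not> (\<forall>\<^sub>\<approx>z\<in>shadow \<Omega>. P z)"
  shows "\<not> (\<forall>\<^sub>\<approx>z\<in>shadow \<Omega>. False)"
proof
  assume "\<forall>\<^sub>\<approx>z\<in>shadow \<Omega>. False"
  then have "\<forall>\<^sub>\<approx>z\<in>shadow \<Omega>. P z" by eventually_elim simp
  with assms show False by simp
qed

text \<open>
The scalar coordinate of the normalized element is \<open>1/2\<close>, which tells it apart from \<open>0\<close> and \<open>1\<close>.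
\<close>
lemma sem_idempotent_of_norm_zero:
  assumes u: "(\<lambda>z. bscalar (inverse (2 * b0 (u z))) * u z) \<in> mero_stems \<Omega>"
    and N: "\<forall>\<^sub>\<approx>z\<in>shadow \<Omega>. bnorm (u z) = 0" and c: "\<forall>\<^sub>\<approx>z\<in>shadow \<Omega>. b0 (u z) \<noteq> 0"
    and ne: "\<not> (\<forall>\<^sub>\<approx>z\<in>shadow \<Omega>. False)"
  shows "sem_idempotent \<Omega> (sem_of_stem \<Omega> (\<lambda>z. bscalar (inverse (2 * b0 (u z))) * u z))"
proof -
  define r where "r z = bscalar (inverse (2 * b0 (u z))) * u z" for z
  have r: "r \<in> mero_stems \<Omega>" using u by (simp add: r_def[abs_def])
  have trace: "\<forall>\<^sub>\<approx>z\<in>shadow \<Omega>. b0 (r z) = 1 / 2"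
    using c by eventually_elim (simp add: r_def bscalar_def biquat_arith)
  have "\<not> (\<forall>\<^sub>\<approx>z\<in>shadow \<Omega>. r z = q)" if "b0 q \<noteq> 1 / 2" for q
  proof
    assume "\<forall>\<^sub>\<approx>z\<in>shadow \<Omega>. r z = q"
    with trace have "\<forall>\<^sub>\<approx>z\<in>shadow \<Omega>. False"
      by eventually_elim (use that in simp)
    with ne show False by simp
  qed
  from this[of 0] this[of 1] have "sem_of_stem \<Omega> r \<noteq> \<zero>\<^bsub>SEM \<Omega>\<^esub>" "sem_of_stem \<Omega> r \<noteq> \<one>\<^bsub>SEM \<Omega>\<^esub>"
    by (simp_all add: sem_zero_eq sem_one_eq sem_of_stem_eq_iff[OF r] biquat_arith)
  moreover have "\<forall>\<^sub>\<approx>z\<in>shadow \<Omega>. r z * r z = r z"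
    using N c unfolding r_def by eventually_elim (rule norm_zero_idempotent)
  ultimately have "sem_idempotent \<Omega> (sem_of_stem \<Omega> r)"
    using r by (simp add: sem_idempotent_def sem_of_stem_carrier sem_of_stem_mult
        sem_of_stem_eq_iff mero_stems_mult)
  then show ?thesis by (simp only: r_def[abs_def])
qed

text \<open>
The definitions of \<open>\<rho>\<^sub>f\<close> and \<open>\<sigma>\<^sub>f\<close> select an idempotent by an equation \<open>f = P(S)\<close>.  If this equation
is solved pointwise by \<open>r\<close> alone, almost everywhere, then the selected element is the class of \<open>r\<close>.
\<close>
lemma the_idempotent_factor:
  assumes idem: "sem_idempotent \<Omega> (sem_of_stem \<Omega> r)" and h: "h \<in> mero_stems \<Omega>" and r: "r \<in> mero_stems \<Omega>"
    and P: "\<And>s. s \<in> mero_stems \<Omega> \<Longrightarrow> P (sem_of_stem \<Omega> s) = sem_of_stem \<Omega> (\<lambda>z. t z (s z))"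
    and solve: "\<forall>\<^sub>\<approx>z\<in>shadow \<Omega>. \<forall>s. h z = t z s \<longleftrightarrow> s = r z"
  shows "(THE S. sem_idempotent \<Omega> S \<and> sem_of_stem \<Omega> h = P S) = sem_of_stem \<Omega> r"
proof (rule the_equality, intro conjI idem)
  have "\<forall>\<^sub>\<approx>z\<in>shadow \<Omega>. h z = t z (r z)"
    using solve by eventually_elim simp
  then show "sem_of_stem \<Omega> h = P (sem_of_stem \<Omega> r)"
    unfolding P[OF r] by (intro sem_of_stem_eqI h)
next
  fix S assume S: "sem_idempotent \<Omega> S \<and> sem_of_stem \<Omega> h = P S"
  then have "S \<in> carrier (SEM \<Omega>)" by (simp add: sem_idempotent_def)
  then obtain s where s: "s \<in> mero_stems \<Omega>" "S = sem_of_stem \<Omega> s" by (rule carrier_SEM_E)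
  have "sem_of_stem \<Omega> h = sem_of_stem \<Omega> (\<lambda>z. t z (s z))"
    using S s(2) P[OF s(1)] by simp
  then have "\<forall>\<^sub>\<approx>z\<in>shadow \<Omega>. h z = t z (s z)"
    by (rule iffD1[OF sem_of_stem_eq_iff[OF h]])
  with solve have "\<forall>\<^sub>\<approx>z\<in>shadow \<Omega>. s z = r z" by eventually_elim blast
  then show "S = sem_of_stem \<Omega> r" unfolding s(2) by (intro sem_of_stem_eqI s)
qed

lemma mero_stems_inverse_trace:
  assumes "u \<in> mero_stems \<Omega>"
  shows "(\<lambda>z. bscalar (inverse (2 * b0 (u z)))) \<in> mero_stems \<Omega>"
proof -
  have "b0 (u (cnj z)) = cnj (b0 (u z))" "(\<lambda>z. b0 (u z)) meromorphic_on shadow \<Omega>" for z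
    using mero_stems_coord[OF assms, of b0] by (simp_all add: mero_stems_bscalar_iff bcoords_def)
  then show ?thesis
    unfolding mero_stems_bscalar_iff by (intro conjI allI meromorphic_intros) simp_all
qed

lemma trace_nonzero:
  assumes "connected \<Omega>" and h: "h \<in> mero_stems \<Omega>"
    and "sem_re \<Omega> (sem_of_stem \<Omega> h \<otimes>\<^bsub>SEM \<Omega>\<^esub> sem_const \<Omega> \<eta>) \<noteq> \<zero>\<^bsub>SEM \<Omega>\<^esub>"
  shows "\<forall>\<^sub>\<approx>z\<in>shadow \<Omega>. b0 (h z * bquat \<eta>) \<noteq> 0"
proof -
  have m: "(\<lambda>z. h z * bquat \<eta>) \<in> mero_stems \<Omega>"
    by (intro mero_stems_mult mero_stems_bquat h)
  then have k: "(\<lambda>z. bscalar (b0 (h z * bquat \<eta>))) \<in> mero_stems \<Omega>"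
    by (intro mero_stems_coord) (auto simp: bcoords_def)
  have "\<not> (\<forall>\<^sub>\<approx>z\<in>shadow \<Omega>. b0 (h z * bquat \<eta>) = 0)"
    using assms(3) by (simp add: sem_const_eq sem_of_stem_mult h mero_stems_bquat sem_re_eq m
        sem_of_stem_eq_0_iff k)
  with mero_dichotomy[OF assms(1) k] show ?thesis by blast
qed

text \<open>
The stem of \<open>\<rho>\<^sub>f\<close> is \<open>\<eta> a\<close> divided by twice its scalar part.  That part equals \<open>(a \<eta>)\<^sub>0\<close> by the trace
property, and \<open>\<eta> a\<close> has norm zero because \<open>a\<close> has.
\<close>
lemma sem_rho_eq:
  assumes conn: "connected \<Omega>" and h: "h \<in> mero_stems \<Omega>"
    and zd: "sem_zero_divisor \<Omega> (sem_of_stem \<Omega> h)" and \<eta>: "norm \<eta> = 1"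
    and re: "sem_re \<Omega> (sem_of_stem \<Omega> h \<otimes>\<^bsub>SEM \<Omega>\<^esub> sem_const \<Omega> \<eta>) \<noteq> \<zero>\<^bsub>SEM \<Omega>\<^esub>"
  obtains r where "r \<in> mero_stems \<Omega>" "sem_rho \<Omega> (sem_of_stem \<Omega> h) \<eta> = sem_of_stem \<Omega> r"
    "\<forall>\<^sub>\<approx>z\<in>shadow \<Omega>. \<exists>c. c \<noteq> 0 \<and> r z = bscalar c * bquat \<eta> * h z"
proof -
  define u where "u z = bquat \<eta> * h z" for z
  define r where "r z = bscalar (inverse (2 * b0 (u z))) * u z" for z
  have u: "u \<in> mero_stems \<Omega>"
    unfolding u_def by (intro mero_stems_mult mero_stems_bquat h)
  have hm: "(\<lambda>z. h z * bquat \<eta>) \<in> mero_stems \<Omega>"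
    by (intro mero_stems_mult mero_stems_bquat h)
  have r: "r \<in> mero_stems \<Omega>"
    unfolding r_def by (intro mero_stems_mult mero_stems_inverse_trace u)
  have tr: "b0 (h z * bquat \<eta>) = b0 (u z)" for z by (simp add: u_def b0_commute)
  have c: "\<forall>\<^sub>\<approx>z\<in>shadow \<Omega>. b0 (u z) \<noteq> 0"
    using trace_nonzero[OF conn h re] by (simp add: tr)
  have c_mero: "(\<lambda>z. bscalar (b0 (u z))) \<in> mero_stems \<Omega>"
    by (rule mero_stems_coord[OF u]) (simp add: bcoords_def)
  have hN: "\<not> (\<forall>\<^sub>\<approx>z\<in>shadow \<Omega>. h z = 0)" "\<forall>\<^sub>\<approx>z\<in>shadow \<Omega>. bnorm (h z) = 0"
    using zd by (auto simp: sem_zero_divisor_iff h)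
  have N: "\<forall>\<^sub>\<approx>z\<in>shadow \<Omega>. bnorm (u z) = 0"
    using hN(2) by eventually_elim (simp add: u_def bnorm_mult)
  have idem: "sem_idempotent \<Omega> (sem_of_stem \<Omega> r)"
    using sem_idempotent_of_norm_zero[OF _ N c cosparse_shadow_nontrivial[OF hN(1)]] r
    by (simp add: r_def[abs_def])
  have product: "sem_const \<Omega> 2 \<otimes>\<^bsub>SEM \<Omega>\<^esub> sem_re \<Omega> (sem_of_stem \<Omega> h \<otimes>\<^bsub>SEM \<Omega>\<^esub> sem_const \<Omega> \<eta>)
      \<otimes>\<^bsub>SEM \<Omega>\<^esub> sem_const \<Omega> (qcnj \<eta>) \<otimes>\<^bsub>SEM \<Omega>\<^esub> sem_of_stem \<Omega> s
    = sem_of_stem \<Omega> (\<lambda>z. bquat 2 * bscalar (b0 (u z)) * bquat (qcnj \<eta>) * s z)"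
    if "s \<in> mero_stems \<Omega>" for s
    using that h
    by (simp add: sem_const_eq sem_of_stem_mult sem_re_eq mero_stems_bquat mero_stems_mult hm tr c_mero)
  have solve: "h z = bquat 2 * bscalar (b0 (u z)) * bquat (qcnj \<eta>) * s \<longleftrightarrow> s = r z"
    if "b0 (u z) \<noteq> 0" for z s
  proof -
    have "bquat 2 * bscalar (b0 (u z)) * bquat (qcnj \<eta>) * s = bscalar (2 * b0 (u z)) * (bquat (qcnj \<eta>) * s)"
      by (simp only: bquat_2 bscalar_mult mult.assoc[of "bscalar (2 * b0 (u z))"])
    then show ?thesis
      using solve_unitary_left[of "2 * b0 (u z)" \<eta> "h z" s] that \<eta> by (simp only: r_def) (simp add: u_def)
  qed
  have "sem_rho \<Omega> (sem_of_stem \<Omega> h) \<eta> = sem_of_stem \<Omega> r"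
    unfolding sem_rho_def
  proof (rule the_idempotent_factor[where t = "\<lambda>z s. bquat 2 * bscalar (b0 (u z)) * bquat (qcnj \<eta>) * s",
      OF idem h r product])
    show "\<forall>\<^sub>\<approx>z\<in>shadow \<Omega>. \<forall>s. h z = bquat 2 * bscalar (b0 (u z)) * bquat (qcnj \<eta>) * s \<longleftrightarrow> s = r z"
      using c by eventually_elim (simp add: solve)
  qed
  moreover have "\<forall>\<^sub>\<approx>z\<in>shadow \<Omega>. \<exists>d. d \<noteq> 0 \<and> r z = bscalar d * bquat \<eta> * h z"
    using c
  proof eventually_elim
    case (elim z)
    then show ?case
      by (intro exI[of _ "inverse (2 * b0 (u z))"]) (simp add: r_def u_def mult.assoc)
  qed
  ultimately show ?thesis by (rule that[OF r])
qed

text \<open>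
The mirror image of \<open>sem_rho_eq\<close>, with \<open>a \<eta>\<close> in place of \<open>\<eta> a\<close>.
\<close>
lemma sem_sigma_eq:
  assumes conn: "connected \<Omega>" and h: "h \<in> mero_stems \<Omega>"
    and zd: "sem_zero_divisor \<Omega> (sem_of_stem \<Omega> h)" and \<eta>: "norm \<eta> = 1"
    and re: "sem_re \<Omega> (sem_of_stem \<Omega> h \<otimes>\<^bsub>SEM \<Omega>\<^esub> sem_const \<Omega> \<eta>) \<noteq> \<zero>\<^bsub>SEM \<Omega>\<^esub>"
  obtains r where "r \<in> mero_stems \<Omega>" "sem_sigma \<Omega> (sem_of_stem \<Omega> h) \<eta> = sem_of_stem \<Omega> r"
    "\<forall>\<^sub>\<approx>z\<in>shadow \<Omega>. \<exists>c. c \<noteq> 0 \<and> r z = bscalar c * h z * bquat \<eta>"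
proof -
  define u where "u z = h z * bquat \<eta>" for z
  define r where "r z = bscalar (inverse (2 * b0 (u z))) * u z" for z
  have u: "u \<in> mero_stems \<Omega>"
    unfolding u_def by (intro mero_stems_mult mero_stems_bquat h)
  have r: "r \<in> mero_stems \<Omega>"
    unfolding r_def by (intro mero_stems_mult mero_stems_inverse_trace u)
  have c: "\<forall>\<^sub>\<approx>z\<in>shadow \<Omega>. b0 (u z) \<noteq> 0"
    using trace_nonzero[OF conn h re] by (simp add: u_def)
  have c_mero: "(\<lambda>z. bscalar (b0 (u z))) \<in> mero_stems \<Omega>"
    by (rule mero_stems_coord[OF u]) (simp add: bcoords_def)
  have hN: "\<not> (\<forall>\<^sub>\<approx>z\<in>shadow \<Omega>. h z = 0)" "\<forall>\<^sub>\<approx>z\<in>shadow \<Omega>. bnorm (h z) = 0"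
    using zd by (auto simp: sem_zero_divisor_iff h)
  have N: "\<forall>\<^sub>\<approx>z\<in>shadow \<Omega>. bnorm (u z) = 0"
    using hN(2) by eventually_elim (simp add: u_def bnorm_mult)
  have idem: "sem_idempotent \<Omega> (sem_of_stem \<Omega> r)"
    using sem_idempotent_of_norm_zero[OF _ N c cosparse_shadow_nontrivial[OF hN(1)]] r
    by (simp add: r_def[abs_def])
  have product: "sem_const \<Omega> 2 \<otimes>\<^bsub>SEM \<Omega>\<^esub> sem_re \<Omega> (sem_of_stem \<Omega> h \<otimes>\<^bsub>SEM \<Omega>\<^esub> sem_const \<Omega> \<eta>)
      \<otimes>\<^bsub>SEM \<Omega>\<^esub> sem_of_stem \<Omega> s \<otimes>\<^bsub>SEM \<Omega>\<^esub> sem_const \<Omega> (qcnj \<eta>)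
    = sem_of_stem \<Omega> (\<lambda>z. bquat 2 * bscalar (b0 (u z)) * s z * bquat (qcnj \<eta>))"
    if "s \<in> mero_stems \<Omega>" for s
    using that h u c_mero
    by (simp add: sem_const_eq sem_of_stem_mult sem_re_eq mero_stems_bquat mero_stems_mult u_def)
  have solve: "h z = bquat 2 * bscalar (b0 (u z)) * s * bquat (qcnj \<eta>) \<longleftrightarrow> s = r z"
    if "b0 (u z) \<noteq> 0" for z s
  proof -
    have "bquat 2 * bscalar (b0 (u z)) * s * bquat (qcnj \<eta>) = bscalar (2 * b0 (u z)) * (s * bquat (qcnj \<eta>))"
      by (simp only: bquat_2 bscalar_mult mult.assoc[of "bscalar (2 * b0 (u z))"])
    then show ?thesis
      using solve_unitary_right[of "2 * b0 (u z)" \<eta> "h z" s] that \<eta> by (simp only: r_def) (simp add: u_def)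
  qed
  have "sem_sigma \<Omega> (sem_of_stem \<Omega> h) \<eta> = sem_of_stem \<Omega> r"
    unfolding sem_sigma_def
  proof (rule the_idempotent_factor[where t = "\<lambda>z s. bquat 2 * bscalar (b0 (u z)) * s * bquat (qcnj \<eta>)",
      OF idem h r product])
    show "\<forall>\<^sub>\<approx>z\<in>shadow \<Omega>. \<forall>s. h z = bquat 2 * bscalar (b0 (u z)) * s * bquat (qcnj \<eta>) \<longleftrightarrow> s = r z"
      using c by eventually_elim (simp add: solve)
  qed
  moreover have "\<forall>\<^sub>\<approx>z\<in>shadow \<Omega>. \<exists>d. d \<noteq> 0 \<and> r z = bscalar d * h z * bquat \<eta>"
    using c
  proof eventually_elim
    case (elim z)
    then show ?case
      by (intro exI[of _ "inverse (2 * b0 (u z))"]) (simp add: r_def u_def mult.assoc)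
  qed
  ultimately show ?thesis by (rule that[OF r])
qed

end

section \<open>The kernel\<close>

theorem proposition3p5:
  fixes \<Omega> :: "quat set" and f g \<phi> :: sem and \<eta> \<delta> :: quat
  assumes "circular_domain \<Omega>"
    and "f \<in> carrier (SEM \<Omega>) - {\<zero>\<^bsub>SEM \<Omega>\<^esub>}"
    and "g \<in> carrier (SEM \<Omega>) - {\<zero>\<^bsub>SEM \<Omega>\<^esub>}"
    and "\<not> sem_isomorphism \<Omega> (sem_L \<Omega> f g)"
    and "sem_zero_divisor \<Omega> f \<Longrightarrow>
           norm \<eta> = 1 \<and> sem_re \<Omega> (f \<otimes>\<^bsub>SEM \<Omega>\<^esub> sem_const \<Omega> \<eta>) \<noteq> \<zero>\<^bsub>SEM \<Omega>\<^esub>"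
    and "sem_zero_divisor \<Omega> g \<Longrightarrow>
           norm \<delta> = 1 \<and> sem_re \<Omega> (g \<otimes>\<^bsub>SEM \<Omega>\<^esub> sem_const \<Omega> \<delta>) \<noteq> \<zero>\<^bsub>SEM \<Omega>\<^esub>"
    and "\<phi> \<in> carrier (SEM \<Omega>)"
  shows
    "(sem_zero_divisor \<Omega> f \<and> \<not> sem_zero_divisor \<Omega> g \<longrightarrow>
       (\<phi> \<in> a_kernel (SEM \<Omega>) (SEM \<Omega>) (sem_L \<Omega> f g) \<longleftrightarrow>
        sem_rho \<Omega> f \<eta> \<otimes>\<^bsub>SEM \<Omega>\<^esub> \<phi> = \<zero>\<^bsub>SEM \<Omega>\<^esub>)) \<and>
     (sem_zero_divisor \<Omega> g \<and> \<not> sem_zero_divisor \<Omega> f \<longrightarrow>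
       (\<phi> \<in> a_kernel (SEM \<Omega>) (SEM \<Omega>) (sem_L \<Omega> f g) \<longleftrightarrow>
        \<phi> \<otimes>\<^bsub>SEM \<Omega>\<^esub> sem_sigma \<Omega> g \<delta> = \<zero>\<^bsub>SEM \<Omega>\<^esub>)) \<and>
     (sem_zero_divisor \<Omega> f \<and> sem_zero_divisor \<Omega> g \<longrightarrow>
       (\<phi> \<in> a_kernel (SEM \<Omega>) (SEM \<Omega>) (sem_L \<Omega> f g) \<longleftrightarrow>
        sem_rho \<Omega> f \<eta> \<otimes>\<^bsub>SEM \<Omega>\<^esub> \<phi> \<otimes>\<^bsub>SEM \<Omega>\<^esub> sem_sigma \<Omega> g \<delta> = \<zero>\<^bsub>SEM \<Omega>\<^esub>))"
proof -
  have conn: "connected \<Omega>" and "open_circular_set \<Omega>"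
    using assms(1) by (simp_all add: circular_domain_def open_circular_set_def)
  then interpret open_circular_set \<Omega> by simp
  obtain a where a: "a \<in> mero_stems \<Omega>" and f: "f = sem_of_stem \<Omega> a"
    using assms(2) carrier_SEM_E by blast
  obtain b where b: "b \<in> mero_stems \<Omega>" and g: "g = sem_of_stem \<Omega> b"
    using assms(3) carrier_SEM_E by blast
  obtain x where x: "x \<in> mero_stems \<Omega>" and \<phi>: "\<phi> = sem_of_stem \<Omega> x"
    using assms(7) carrier_SEM_E by blast
  have kernel: "\<phi> \<in> a_kernel (SEM \<Omega>) (SEM \<Omega>) (sem_L \<Omega> f g) \<longleftrightarrow>
      (\<forall>\<^sub>\<approx>z\<in>shadow \<Omega>. a z * x z * b z = 0)"
    using assms(7) a b x
    by (simp add: a_kernel_def' sem_L_def f g \<phi> sem_of_stem_mult mero_stems_mult sem_of_stem_eq_0_iff)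
  \<comment> \<open>\<open>\<rho>\<^sub>f\<close> and \<open>f\<close> have the same right annihilator, pointwise almost everywhere.\<close>
  have rho: "\<exists>r \<in> mero_stems \<Omega>. sem_rho \<Omega> f \<eta> = sem_of_stem \<Omega> r \<and>
      (\<forall>\<^sub>\<approx>z\<in>shadow \<Omega>. \<forall>y. r z * y = 0 \<longleftrightarrow> a z * y = 0)" if zd: "sem_zero_divisor \<Omega> f"
  proof -
    have unit: "norm \<eta> = 1"
      and re: "sem_re \<Omega> (sem_of_stem \<Omega> a \<otimes>\<^bsub>SEM \<Omega>\<^esub> sem_const \<Omega> \<eta>) \<noteq> \<zero>\<^bsub>SEM \<Omega>\<^esub>"
      using assms(5)[OF zd] by (simp_all add: f)
    obtain r where r: "r \<in> mero_stems \<Omega>" "sem_rho \<Omega> f \<eta> = sem_of_stem \<Omega> r"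
      "\<forall>\<^sub>\<approx>z\<in>shadow \<Omega>. \<exists>c. c \<noteq> 0 \<and> r z = bscalar c * bquat \<eta> * a z"
      unfolding f by (rule sem_rho_eq[OF conn a zd[unfolded f] unit re])
    have "\<forall>\<^sub>\<approx>z\<in>shadow \<Omega>. \<forall>y. r z * y = 0 \<longleftrightarrow> a z * y = 0"
      using r(3)
    proof (eventually_elim, intro allI)
      fix z y assume "\<exists>c. c \<noteq> 0 \<and> r z = bscalar c * bquat \<eta> * a z"
      then obtain c where "c \<noteq> 0" "r z = bscalar c * bquat \<eta> * a z" by blast
      with unit show "r z * y = 0 \<longleftrightarrow> a z * y = 0"
        by (simp add: mult.assoc bscalar_mult_eq_0_iff bquat_mult_eq_0_iff)
    qed
    with r show ?thesis by (intro bexI[of _ r] conjI)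
  qed
  have sigma: "\<exists>s \<in> mero_stems \<Omega>. sem_sigma \<Omega> g \<delta> = sem_of_stem \<Omega> s \<and>
      (\<forall>\<^sub>\<approx>z\<in>shadow \<Omega>. \<forall>y. y * s z = 0 \<longleftrightarrow> y * b z = 0)" if zd: "sem_zero_divisor \<Omega> g"
  proof -
    have unit: "norm \<delta> = 1"
      and re: "sem_re \<Omega> (sem_of_stem \<Omega> b \<otimes>\<^bsub>SEM \<Omega>\<^esub> sem_const \<Omega> \<delta>) \<noteq> \<zero>\<^bsub>SEM \<Omega>\<^esub>"
      using assms(6)[OF zd] by (simp_all add: g)
    obtain s where s: "s \<in> mero_stems \<Omega>" "sem_sigma \<Omega> g \<delta> = sem_of_stem \<Omega> s"
      "\<forall>\<^sub>\<approx>z\<in>shadow \<Omega>. \<exists>c. c \<noteq> 0 \<and> s z = bscalar c * b z * bquat \<delta>"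
      unfolding g by (rule sem_sigma_eq[OF conn b zd[unfolded g] unit re])
    have "\<forall>\<^sub>\<approx>z\<in>shadow \<Omega>. \<forall>y. y * s z = 0 \<longleftrightarrow> y * b z = 0"
      using s(3)
    proof (eventually_elim, intro allI)
      fix z y assume "\<exists>c. c \<noteq> 0 \<and> s z = bscalar c * b z * bquat \<delta>"
      then obtain c where c: "c \<noteq> 0" "s z = bscalar c * b z * bquat \<delta>" by blast
      then have "y * s z = bscalar c * (y * b z * bquat \<delta>)"
        by (metis bscalar_central mult.assoc)
      with c unit show "y * s z = 0 \<longleftrightarrow> y * b z = 0"
        by (simp add: bscalar_mult_eq_0_iff bquat_mult_eq_0_iff)
    qed
    with s show ?thesis by (intro bexI[of _ s] conjI)
  qed
  have regular: "\<forall>\<^sub>\<approx>z\<in>shadow \<Omega>. bnorm (h z) \<noteq> 0"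
    if "h \<in> mero_stems \<Omega>" "sem_of_stem \<Omega> h \<noteq> \<zero>\<^bsub>SEM \<Omega>\<^esub>" "\<not> sem_zero_divisor \<Omega> (sem_of_stem \<Omega> h)" for h
    using that non_zero_divisor_bnorm[OF conn] by blast
  show ?thesis
  proof (intro conjI impI)
    assume zd: "sem_zero_divisor \<Omega> f \<and> \<not> sem_zero_divisor \<Omega> g"
    then obtain r where r: "r \<in> mero_stems \<Omega>" "sem_rho \<Omega> f \<eta> = sem_of_stem \<Omega> r"
      "\<forall>\<^sub>\<approx>z\<in>shadow \<Omega>. \<forall>y. r z * y = 0 \<longleftrightarrow> a z * y = 0" using rho by blast
    have "\<forall>\<^sub>\<approx>z\<in>shadow \<Omega>. bnorm (b z) \<noteq> 0" using regular[OF b] zd assms(3) by (simp add: g)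
    with r(3) have "\<forall>\<^sub>\<approx>z\<in>shadow \<Omega>. a z * x z * b z = 0 \<longleftrightarrow> r z * x z = 0"
      by eventually_elim (simp add: mult_bnorm_nonzero_eq_0_iff)
    moreover have e: "sem_rho \<Omega> f \<eta> \<otimes>\<^bsub>SEM \<Omega>\<^esub> \<phi> = \<zero>\<^bsub>SEM \<Omega>\<^esub> \<longleftrightarrow>
        (\<forall>\<^sub>\<approx>z\<in>shadow \<Omega>. r z * x z = 0)"
      by (simp add: r(2) \<phi> sem_of_stem_mult sem_of_stem_eq_0_iff mero_stems_mult r(1) x)
    ultimately show "\<phi> \<in> a_kernel (SEM \<Omega>) (SEM \<Omega>) (sem_L \<Omega> f g) \<longleftrightarrow>
        sem_rho \<Omega> f \<eta> \<otimes>\<^bsub>SEM \<Omega>\<^esub> \<phi> = \<zero>\<^bsub>SEM \<Omega>\<^esub>"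
      unfolding kernel e by (intro eventually_iff_cong)
  next
    assume zd: "sem_zero_divisor \<Omega> g \<and> \<not> sem_zero_divisor \<Omega> f"
    then obtain s where s: "s \<in> mero_stems \<Omega>" "sem_sigma \<Omega> g \<delta> = sem_of_stem \<Omega> s"
      "\<forall>\<^sub>\<approx>z\<in>shadow \<Omega>. \<forall>y. y * s z = 0 \<longleftrightarrow> y * b z = 0" using sigma by blast
    have "\<forall>\<^sub>\<approx>z\<in>shadow \<Omega>. bnorm (a z) \<noteq> 0" using regular[OF a] zd assms(2) by (simp add: f)
    with s(3) have "\<forall>\<^sub>\<approx>z\<in>shadow \<Omega>. a z * x z * b z = 0 \<longleftrightarrow> x z * s z = 0"
      by eventually_elim (simp add: mult.assoc mult_bnorm_nonzero_eq_0_iff)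
    moreover have e: "\<phi> \<otimes>\<^bsub>SEM \<Omega>\<^esub> sem_sigma \<Omega> g \<delta> = \<zero>\<^bsub>SEM \<Omega>\<^esub> \<longleftrightarrow>
        (\<forall>\<^sub>\<approx>z\<in>shadow \<Omega>. x z * s z = 0)"
      by (simp add: s(2) \<phi> sem_of_stem_mult sem_of_stem_eq_0_iff mero_stems_mult s(1) x)
    ultimately show "\<phi> \<in> a_kernel (SEM \<Omega>) (SEM \<Omega>) (sem_L \<Omega> f g) \<longleftrightarrow>
        \<phi> \<otimes>\<^bsub>SEM \<Omega>\<^esub> sem_sigma \<Omega> g \<delta> = \<zero>\<^bsub>SEM \<Omega>\<^esub>"
      unfolding kernel e by (intro eventually_iff_cong)
  next
    assume zd: "sem_zero_divisor \<Omega> f \<and> sem_zero_divisor \<Omega> g"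
    then obtain r where r: "r \<in> mero_stems \<Omega>" "sem_rho \<Omega> f \<eta> = sem_of_stem \<Omega> r"
      "\<forall>\<^sub>\<approx>z\<in>shadow \<Omega>. \<forall>y. r z * y = 0 \<longleftrightarrow> a z * y = 0" using rho by blast
    obtain s where s: "s \<in> mero_stems \<Omega>" "sem_sigma \<Omega> g \<delta> = sem_of_stem \<Omega> s"
      "\<forall>\<^sub>\<approx>z\<in>shadow \<Omega>. \<forall>y. y * s z = 0 \<longleftrightarrow> y * b z = 0" using sigma zd by blast
    have "\<forall>\<^sub>\<approx>z\<in>shadow \<Omega>. a z * x z * b z = 0 \<longleftrightarrow> r z * x z * s z = 0"
      using r(3) s(3) by eventually_elim (metis mult.assoc)
    moreover have e: "sem_rho \<Omega> f \<eta> \<otimes>\<^bsub>SEM \<Omega>\<^esub> \<phi> \<otimes>\<^bsub>SEM \<Omega>\<^esub> sem_sigma \<Omega> g \<delta> = \<zero>\<^bsub>SEM \<Omega>\<^esub> \<longleftrightarrow>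
        (\<forall>\<^sub>\<approx>z\<in>shadow \<Omega>. r z * x z * s z = 0)"
      by (simp add: r(2) s(2) \<phi> sem_of_stem_mult sem_of_stem_eq_0_iff mero_stems_mult r(1) s(1) x)
    ultimately show "\<phi> \<in> a_kernel (SEM \<Omega>) (SEM \<Omega>) (sem_L \<Omega> f g) \<longleftrightarrow>
        sem_rho \<Omega> f \<eta> \<otimes>\<^bsub>SEM \<Omega>\<^esub> \<phi> \<otimes>\<^bsub>SEM \<Omega>\<^esub> sem_sigma \<Omega> g \<delta> = \<zero>\<^bsub>SEM \<Omega>\<^esub>"
      unfolding kernel e by (intro eventually_iff_cong)
  qed
qed

end
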